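(* Consider the non-backtracking exploration. Suppose that $G_n=\mathrm{CM}_n(\mathbf d_n)$ is the configuration model with $\inf_{n\in\mathbb N}\inf_{i\in[n]}d_i^{(G_n)}\ge3$ and $\sup_{n\in\mathbb N}\sup_{i\in[n]}d_i^{(G_n)}=M<\infty$. Let $D_n$ be the degree of a uniformly chosen vertex in $[n]$. Let $(m_n)$ be a sequence in $\mathbb N$ with $m_n=o\big(\sqrt{n/d_{\max}}\big)$ as $n\to\infty$, where $d_{\max}=o(n)$ is the maximum vertex degree in $\mathbf d_n$. If $D_n$ converges in distribution to $D$ with $\mathbb P\{D\ge1\}=1$, then for any $k_n\in\mathbb N$ with $k_n\le\frac{\log m_n}{2\log M}$ and $k_n\to\infty$ as $n\to\infty$, $\mu_n^{(k_n)}$ converges weakly to $\mu$ in distribution as $n\to\infty$, where $\mu$ is the law of $$\Delta_\phi=\frac{\mathbb E[D^2]}{\mathbb E[D]}-d_\phi,$$ and $d_\phi$ has the same distribution as $D$.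
   Context: $\mathrm{CM}_n(\mathbf d_n)$ is the configuration model on $[n]=\{1,\dots,n\}$ with degree sequence $\mathbf d_n$ (of even total degree): vertex $i$ receives $d_i$ half-edges, and the half-edges are paired uniformly at random; the result is a random multi-graph in which vertex $i$ has degree $d_i^{(G_n)}=d_i$ (a self-loop counts $2$). The local limit of this random graph is the unimodular branching process tree $(G_\infty,\phi)$ in which the root $\phi$ has offspring distribution $p_k=\mathbb P\{D=k\}$ and all other vertices have offspring distribution $p^\star_k=(k+1)p_{k+1}/\mathbb E[D]$; $d_\phi$ is the number of offspring of its root. Non-backtracking exploration: on a multi-graph the non-backtracking random walk moves along edges. It starts at a vertex $i$, first crosses the edge of a uniformly chosen half-edge incident to $i$, and subsequently at each step it crosses the edge of a uniformly chosen half-edge incident to its current vertex, but not along the edge it has just crossed (it may go back along another edge between the same pair of vertices). $P_n^{(k)}(i,j)$ is the probability, given $G_n$, that the walk started at $i$ is at $j$ after $k$ steps. On a simple graph this is the walk that moves to a uniformly chosen neighbour different from the vertex visited immediately before. The $k$-level friendship bias is $\Delta_{i,n}^{(k)}=\sum_{j\in[n]}P_n^{(k)}(i,j)\,d_j^{(G_n)}-d_i^{(G_n)}$, and $\mu_n^{(k)}=\frac1n\sum_{i\in[n]}\delta_{\Delta_{i,n}^{(k)}}$ (a random measure). Weak convergence in distribution of random measures $\nu_n$ to $\nu$ means $\int f\,d\nu_n\to\int f\,d\nu$ in distribution for every bounded continuous $f:\mathbb R\to\mathbb R$. *)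

theory Defs
  imports
    "HOL-Probability.Probability"
    "HOL-Combinatorics.Permutations"
    "HOL-Library.Landau_Symbols"
    "HOL-Library.Extended_Nat"
begin

section \<open>The configuration model\<close>

text \<open>
  The \<open>a\<close>-th half-edge of vertex \<open>i\<close> is the pair \<open>(i, a)\<close>, so \<open>fst\<close> sends a half-edge
  to the vertex it is attached to.
\<close>

type_synonym half_edge = "nat \<times> nat"

definition half_edges :: "nat \<Rightarrow> (nat \<Rightarrow> nat) \<Rightarrow> half_edge set" where
  "half_edges n d = (SIGMA i:{1..n}. {..<d i})"

text \<open>
  A pairing of a set \<open>H\<close> of half-edges is encoded by the fixed-point-free involution of \<open>H\<close>
  that sends each half-edge to its partner (and is the identity outside \<open>H\<close>).  Together with
  \<open>H\<close> it describes a multi-graph whose edges are the sets \<open>{h, p h}\<close>, \<open>h \<in> H\<close>.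
\<close>

definition pairings :: "half_edge set \<Rightarrow> (half_edge \<Rightarrow> half_edge) set" where
  "pairings H = {p. p permutes H \<and> (\<forall>h\<in>H. p h \<noteq> h \<and> p (p h) = h)}"

definition config_model :: "nat \<Rightarrow> (nat \<Rightarrow> nat) \<Rightarrow> (half_edge \<Rightarrow> half_edge) pmf" where
  "config_model n d = pmf_of_set (pairings (half_edges n d))"

definition max_degree :: "nat \<Rightarrow> (nat \<Rightarrow> nat) \<Rightarrow> nat" where
  "max_degree n d = Max (d ` {1..n})"

definition incident :: "half_edge set \<Rightarrow> nat \<Rightarrow> half_edge set" where
  "incident H i = {h \<in> H. fst h = i}"

text \<open>Both halves of a self-loop are incident to its vertex, so a self-loop counts twice.\<close>

definition degree :: "half_edge set \<Rightarrow> nat \<Rightarrow> nat" where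
  "degree H i = card (incident H i)"

lemma finite_half_edges [simp]: "finite (half_edges n d)"
  by (simp add: half_edges_def)

lemma card_half_edges: "card (half_edges n d) = (\<Sum>i=1..n. d i)"
  by (simp add: half_edges_def)

lemma degree_half_edges:
  assumes "i \<in> {1..n}"
  shows "degree (half_edges n d) i = d i"
proof -
  have "incident (half_edges n d) i = {i} \<times> {..<d i}"
    using assms by (auto simp: incident_def half_edges_def)
  then show ?thesis
    by (simp add: degree_def card_cartesian_product)
qed

lemma finite_pairings:
  assumes "finite H"
  shows "finite (pairings H)"
  unfolding pairings_def
  by (rule finite_subset[OF _ finite_permutations[OF assms]]) auto

lemma pairings_nonempty:
  assumes "finite H" "even (card H)"
  shows "pairings H \<noteq> {}"
proof -
  have "\<exists>p. p \<in> pairings H" if "finite H" "card H = 2 * k" for k and H :: "half_edge set"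
    using that
  proof (induction k arbitrary: H)
    case 0
    then show ?case
      by (intro exI[of _ id]) (auto simp: pairings_def permutes_id)
  next
    case (Suc k)
    then obtain a B where a: "H = insert a B" "a \<notin> B" "card B = Suc (2 * k)"
      by (metis card_Suc_eq mult_Suc_right add_2_eq_Suc)
    then obtain b C where b: "B = insert b C" "b \<notin> C" "card C = 2 * k"
      by (metis card_Suc_eq)
    have "finite C"
      using Suc.prems a b by auto
    then obtain q where q: "q \<in> pairings C"
      using Suc.IH b by blast
    have abC: "a \<noteq> b" "a \<notin> C" "b \<notin> C" and H: "H = insert a (insert b C)"
      using a b by auto
    have qC: "q permutes C" "\<And>h. h \<in> C \<Longrightarrow> q h \<noteq> h \<and> q (q h) = h"
      using q by (auto simp: pairings_def)
    have qin: "q h \<in> C" if "h \<in> C" for h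
      using that qC(1) by (simp add: permutes_in_image)
    have qout: "q a = a" "q b = b"
      using qC(1) abC by (auto intro: permutes_not_in)
    have "Transposition.transpose a b \<circ> q permutes H"
    proof (rule permutes_compose)
      show "q permutes H"
        by (rule permutes_subset[OF qC(1)]) (auto simp: H)
      show "Transposition.transpose a b permutes H"
        by (rule permutes_swap_id) (auto simp: H)
    qed
    moreover have "(Transposition.transpose a b \<circ> q) h = q h" if "h \<in> C" for h
      using qin[OF that] abC by (auto simp: Transposition.transpose_def)
    ultimately have "Transposition.transpose a b \<circ> q \<in> pairings H"
      using abC qC qin qout by (auto simp: pairings_def H Transposition.transpose_def)
    then show ?case
      by blast
  qed
  with assms show ?thesis
    by (metis evenE empty_iff)
qed

section \<open>The non-backtracking walk\<close>

text \<open>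
  \<open>nb_half_edge H p i l\<close> is the law of the half-edge through which the walk started at \<open>i\<close> leaves
  its current vertex in step \<open>l + 1\<close>.  Leaving through \<open>h\<close> crosses the edge \<open>{h, p h}\<close> and leads
  to the vertex of \<open>p h\<close>.  The next step excludes the edge just crossed, i.e. both of its
  halves; this matters only if that edge is a self-loop, as otherwise \<open>h\<close> is not incident to
  the new vertex.
\<close>

primrec nb_half_edge ::
  "half_edge set \<Rightarrow> (half_edge \<Rightarrow> half_edge) \<Rightarrow> nat \<Rightarrow> nat \<Rightarrow> half_edge pmf" where
  "nb_half_edge H p i 0 = pmf_of_set (incident H i)"
| "nb_half_edge H p i (Suc l) =
     bind_pmf (nb_half_edge H p i l) (\<lambda>h. pmf_of_set (incident H (fst (p h)) - {h, p h}))"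

fun nb_position ::
  "half_edge set \<Rightarrow> (half_edge \<Rightarrow> half_edge) \<Rightarrow> nat \<Rightarrow> nat \<Rightarrow> nat pmf" where
  "nb_position H p i 0 = return_pmf i"
| "nb_position H p i (Suc l) = map_pmf (\<lambda>h. fst (p h)) (nb_half_edge H p i l)"

definition nb_prob ::
  "half_edge set \<Rightarrow> (half_edge \<Rightarrow> half_edge) \<Rightarrow> nat \<Rightarrow> nat \<Rightarrow> nat \<Rightarrow> real" where
  "nb_prob H p k i j = pmf (nb_position H p i k) j"

section \<open>Friendship bias\<close>

definition friendship_bias ::
  "nat \<Rightarrow> (nat \<Rightarrow> nat) \<Rightarrow> (half_edge \<Rightarrow> half_edge) \<Rightarrow> nat \<Rightarrow> nat \<Rightarrow> real" where
  "friendship_bias n d p k i =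
     (let H = half_edges n d
      in (\<Sum>j=1..n. nb_prob H p k i j * real (degree H j)) - real (degree H i))"

text \<open>
  The empirical measure \<open>1/n \<Sum>\<^sub>i \<delta>\<^bsub>\<Delta>\<^sub>i\<^esub>\<close>, written as the image of the uniform distribution on
  the vertices.
\<close>

definition bias_measure ::
  "nat \<Rightarrow> (nat \<Rightarrow> nat) \<Rightarrow> (half_edge \<Rightarrow> half_edge) \<Rightarrow> nat \<Rightarrow> real measure" where
  "bias_measure n d p k =
     distr (measure_pmf (pmf_of_set {1..n})) borel (friendship_bias n d p k)"

lemma measure_bias_measure:
  assumes "n \<ge> 1" "A \<in> sets borel"
  shows "measure (bias_measure n d p k) A =
    1 / real n * (\<Sum>i=1..n. measure (return borel (friendship_bias n d p k i)) A)"
proof -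
  have "measure (bias_measure n d p k) A =
      real (card ({1..n} \<inter> friendship_bias n d p k -` A)) / real n"
    using assms by (simp add: bias_measure_def measure_distr measure_pmf_of_set)
  also have "real (card ({1..n} \<inter> friendship_bias n d p k -` A)) =
      (\<Sum>i=1..n. indicator A (friendship_bias n d p k i))"
    by (simp add: indicator_def sum.If_cases Int_def vimage_def)
  also have "\<dots> = (\<Sum>i=1..n. measure (return borel (friendship_bias n d p k i)) A)"
    using assms by (simp add: measure_return)
  finally show ?thesis
    by simp
qed

section \<open>Weak convergence in distribution of random measures\<close>

text \<open>
  The random measures \<open>\<nu> n\<close> live on the probability spaces \<open>\<Omega> n\<close>, the limit \<open>\<nu>'\<close> on \<open>\<Omega>'\<close>.
\<close>

definition weak_conv_in_distribution ::
  "(nat \<Rightarrow> 'a measure) \<Rightarrow> (nat \<Rightarrow> 'a \<Rightarrow> real measure) \<Rightarrow>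
   'b measure \<Rightarrow> ('b \<Rightarrow> real measure) \<Rightarrow> bool" where
  "weak_conv_in_distribution \<Omega> \<nu> \<Omega>' \<nu>' \<longleftrightarrow>
     (\<forall>f :: real \<Rightarrow> real. continuous_on UNIV f \<and> bounded (range f) \<longrightarrow>
        weak_conv_m (\<lambda>n. distr (\<Omega> n) borel (\<lambda>\<omega>. \<integral>x. f x \<partial>\<nu> n \<omega>))
                    (distr \<Omega>' borel (\<lambda>\<omega>. \<integral>x. f x \<partial>\<nu>' \<omega>)))"

end

theory Submission
  imports Defs
begin

text \<open>
  Write \<open>X\<^sub>i\<close> for the mean degree of the vertex reached from \<open>i\<close> after \<open>k\<close> steps, so that
  \<open>\<Delta>\<^sub>i = X\<^sub>i - d\<^sub>i\<close>.  The degrees \<open>d\<^sub>i\<close> are deterministic, and so is the mean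
  \<open>c\<^sub>n = (\<Sum> d\<^sub>i\<^sup>2) / (\<Sum> d\<^sub>i)\<close> of the degree seen from a uniform half-edge, which tends to
  \<open>c = E[D\<^sup>2] / E[D]\<close>.  The theorem therefore follows once \<open>E[(X\<^sub>i - c\<^sub>n)\<^sup>2]\<close> tends to \<open>0\<close> uniformly
  in \<open>i\<close>: the integral of \<open>f\<close> against the empirical measure is then close in \<open>L\<^sup>2\<close> to the average
  of \<open>f (c - d\<^sub>i)\<close>, which converges to \<open>E[f (c - D)]\<close>.

  The second moment is that of two walks which are independent given the graph and start at the
  same vertex.  The graph is revealed along the walks: the partner of an unpaired half-edge is
  uniform among the other unpaired ones.  Three facts are proved by induction on the number of
  steps, for the centred weight \<open>g = degree - c\<^sub>n\<close> and every partially revealed pairing.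
  One walk that leaves through an unpaired half-edge has mean weight near \<open>0\<close> at its end
  (\<open>one_walk\<close>): as long as it meets only new vertices its last partner is nearly uniform, and
  each step meets an old vertex with probability of order (steps so far) / \<open>n\<close>.  For the same
  reason two walks that leave through different unpaired half-edges are nearly uncorrelated
  (\<open>two_walks\<close>).  Two walks that leave through the same half-edge and reach a new vertex split
  there with probability at least \<open>1/2\<close>, because all degrees are at least \<open>3\<close>; so their correlation is
  at most halved in each step, up to a small error (\<open>second_moment\<close>).

  In total \<open>E[(X\<^sub>i - c\<^sub>n)\<^sup>2]\<close> is of order \<open>2\<^bsup>-k\<^esup> + k\<^sup>2 / n\<close>.  This vanishes as soon as \<open>k\<close> tends to
  infinity and \<open>k = o(\<surd>n)\<close>, which the bound on \<open>k\<^sub>n\<close> yields.  The second moment follows only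
  two paths, so the neighbourhood of \<open>i\<close> as a whole never has to be explored.
\<close>

section \<open>Revealing a uniform pairing edge by edge\<close>

lemma pairingsD:
  assumes "p \<in> pairings H"
  shows "p permutes H" "h \<in> H \<Longrightarrow> p h \<in> H" "h \<in> H \<Longrightarrow> p h \<noteq> h" "p (p h) = h"
proof -
  show *: "p permutes H" using assms by (simp add: pairings_def)
  show "h \<in> H \<Longrightarrow> p h \<in> H" using * by (simp add: permutes_in_image)
  show "h \<in> H \<Longrightarrow> p h \<noteq> h" using assms by (simp add: pairings_def)
  show "p (p h) = h"
    using assms * by (cases "h \<in> H") (auto simp: pairings_def permutes_not_in)
qed

text \<open>
  What remains possible after the edges outside \<open>U\<close> have been revealed.  These edges are recorded
  by a pairing \<open>q\<close> of all of \<open>H\<close>, of which only the values outside \<open>U\<close> matter; since \<open>q\<close>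
  preserves \<open>U\<close>, the half-edges in \<open>U\<close> are paired among themselves.
\<close>

definition cylinder ::
  "half_edge set \<Rightarrow> half_edge set \<Rightarrow> (half_edge \<Rightarrow> half_edge) set \<Rightarrow> bool" where
  "cylinder H U P \<longleftrightarrow> U \<subseteq> H \<and>
     (\<exists>q\<in>pairings H. q ` U \<subseteq> U \<and> P = {p \<in> pairings H. \<forall>h\<in>H - U. p h = q h})"

lemma cylinder_subset: "cylinder H U P \<Longrightarrow> P \<subseteq> pairings H"
  by (auto simp: cylinder_def)

lemma cylinder_pairings: "q \<in> pairings H \<Longrightarrow> cylinder H H (pairings H)"
  unfolding cylinder_def using pairingsD(2)[of q H] by (intro conjI bexI[of _ q]) auto

lemma cylinder_closed:
  assumes "cylinder H U P" "p \<in> P"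
  shows "h \<in> U \<Longrightarrow> p h \<in> U" "h \<in> H - U \<Longrightarrow> p h \<in> H - U"
proof -
  from assms obtain q where q: "q \<in> pairings H" "q ` U \<subseteq> U" and U: "U \<subseteq> H"
    and p: "p \<in> pairings H" "\<And>h. h \<in> H - U \<Longrightarrow> p h = q h"
    by (auto simp: cylinder_def)
  show out: "p h \<in> H - U" if "h \<in> H - U" for h
  proof -
    have "q h \<in> H" using q that by (auto intro: pairingsD)
    moreover have "q h \<notin> U"
      using q that pairingsD(4)[OF q(1), of h] by (metis Diff_iff image_subset_iff)
    ultimately show ?thesis using p that by simp
  qed
  show "p h \<in> U" if "h \<in> U" for h
  proof (rule ccontr)
    assume "p h \<notin> U"
    then have "p h \<in> H - U" using that U pairingsD(2)[OF p(1), of h] by auto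
    from out[OF this] show False using pairingsD(4)[OF p(1)] that by simp
  qed
qed

lemma partner_in_remaining:
  assumes cyl: "cylinder H U P" and h: "h \<in> U"
  shows "(\<lambda>p. p h) ` P \<subseteq> U - {h}"
proof (rule image_subsetI)
  fix p assume p: "p \<in> P"
  have "h \<in> H" using cyl h by (auto simp: cylinder_def)
  moreover have "p \<in> pairings H" using p cylinder_subset[OF cyl] by blast
  ultimately show "p h \<in> U - {h}" using cylinder_closed(1)[OF cyl p h] pairingsD(3) by blast
qed

text \<open>
  Exchanging the roles of two unpaired half-edges \<open>x\<close> and \<open>y\<close> is a symmetry of the conditioned
  model; this is why every possible partner of \<open>h\<close> is equally likely.
\<close>

lemma cylinder_swap:
  assumes cyl: "cylinder H U P" and p: "p \<in> P" and h: "h \<in> U"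
    and x: "x \<in> U - {h}" and y: "y \<in> U - {h}" and ph: "p h = y"
  defines "t \<equiv> Transposition.transpose x y"
  shows "t \<circ> p \<circ> t \<in> P" "(t \<circ> p \<circ> t) h = x"
proof -
  have pH: "p \<in> pairings H" and U: "U \<subseteq> H" using cyl p by (auto simp: cylinder_def)
  have tt: "t (t z) = z" for z by (simp add: t_def)
  have tp: "t permutes H" using x y U by (auto simp: t_def intro: permutes_swap_id)
  then have tH: "t z \<in> H" if "z \<in> H" for z using that by (simp add: permutes_in_image)
  have "(t \<circ> p \<circ> t) permutes H"
    using tp pairingsD(1)[OF pH] by (intro permutes_compose)
  moreover have "(t \<circ> p \<circ> t) z \<noteq> z" if "z \<in> H" for z
    using pairingsD(3)[OF pH tH[OF that]] tt by (metis comp_apply)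
  moreover have "(t \<circ> p \<circ> t) ((t \<circ> p \<circ> t) z) = z" for z
    using pairingsD(4)[OF pH] by (simp add: tt)
  ultimately have "t \<circ> p \<circ> t \<in> pairings H" by (simp add: pairings_def)
  moreover have "(t \<circ> p \<circ> t) z = p z" if "z \<in> H - U" for z
  proof -
    have "z \<noteq> x" "z \<noteq> y" "p z \<noteq> x" "p z \<noteq> y"
      using that x y cylinder_closed(2)[OF cyl p that] by auto
    then show ?thesis by (simp add: t_def)
  qed
  ultimately show "t \<circ> p \<circ> t \<in> P" using cyl p by (auto simp: cylinder_def)
  have "t h = h" unfolding t_def by (rule transpose_apply_other) (use x y in auto)
  then show "(t \<circ> p \<circ> t) h = x" using ph by (simp add: t_def)
qed

lemma card_partner_fibre:
  assumes cyl: "cylinder H U P" and h: "h \<in> U" and x: "x \<in> U - {h}" and y: "y \<in> U - {h}"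
  shows "card {p \<in> P. p h = x} = card {p \<in> P. p h = y}"
proof (rule bij_betw_same_card)
  let ?t = "Transposition.transpose x y"
  have inv: "?t \<circ> (?t \<circ> p \<circ> ?t) \<circ> ?t = p" for p :: "half_edge \<Rightarrow> half_edge"
    by (auto simp: fun_eq_iff)
  show "bij_betw (\<lambda>p. ?t \<circ> p \<circ> ?t) {p \<in> P. p h = x} {p \<in> P. p h = y}"
  proof (rule bij_betw_byWitness[where f' = "\<lambda>p. ?t \<circ> p \<circ> ?t"])
    show "(\<lambda>p. ?t \<circ> p \<circ> ?t) ` {p \<in> P. p h = x} \<subseteq> {p \<in> P. p h = y}"
      using cylinder_swap[OF cyl _ h y x] by (auto simp: transpose_commute)
    show "(\<lambda>p. ?t \<circ> p \<circ> ?t) ` {p \<in> P. p h = y} \<subseteq> {p \<in> P. p h = x}"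
      using cylinder_swap[OF cyl _ h x y] by auto
  qed (use inv in auto)
qed

text \<open>
  Revealing one more edge leads again to a cylinder, so that statements about cylinders can be
  proved by following a walk.  The fibre is nonempty because a swap moves the partner that \<open>h\<close>
  has in some pairing to \<open>x\<close>.
\<close>

lemma cylinder_reveal:
  assumes cyl: "cylinder H U P" and h: "h \<in> U" and x: "x \<in> U - {h}"
  shows "cylinder H (U - {h, x}) {p \<in> P. p h = x}"
proof -
  from cyl obtain q where q: "q \<in> pairings H" "q ` U \<subseteq> U" and U: "U \<subseteq> H"
    and P: "P = {p \<in> pairings H. \<forall>h\<in>H - U. p h = q h}"
    by (auto simp: cylinder_def)
  have qP: "q \<in> P" using P q by simp
  have "q h \<in> U - {h}" using partner_in_remaining[OF cyl h] qP by blast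
  from cylinder_swap[OF cyl qP h x this refl] obtain q' where q': "q' \<in> P" "q' h = x"
    by blast
  have q'H: "q' \<in> pairings H" using q' P by simp
  have q'x: "q' x = h" using pairingsD(4)[OF q'H, of h] q' by simp
  have "q' ` (U - {h, x}) \<subseteq> U - {h, x}"
  proof (rule image_subsetI)
    fix z assume z: "z \<in> U - {h, x}"
    then have "q' z \<in> U" using cylinder_closed(1)[OF cyl q'(1)] by simp
    moreover have "q' z \<noteq> h" "q' z \<noteq> x"
      using z pairingsD(4)[OF q'H, of z] q' q'x by auto
    ultimately show "q' z \<in> U - {h, x}" by simp
  qed
  moreover have "{p \<in> P. p h = x} = {p \<in> pairings H. \<forall>z\<in>H - (U - {h, x}). p z = q' z}"
  proof (intro set_eqI iffI)
    fix p assume "p \<in> {p \<in> P. p h = x}"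
    then have p: "p \<in> pairings H" "p h = x" and "\<And>z. z \<in> H - U \<Longrightarrow> p z = q z"
      using P by blast+
    moreover have "\<And>z. z \<in> H - U \<Longrightarrow> q' z = q z" using P q'(1) by blast
    ultimately have p3: "\<And>z. z \<in> H - U \<Longrightarrow> p z = q' z" by metis
    then have "p x = h" using pairingsD(4)[OF p(1), of h] p(2) by simp
    have "p z = q' z" if "z \<in> H - (U - {h, x})" for z
    proof (cases "z \<in> U")
      case True
      then have "z = h \<or> z = x" using that by blast
      then show ?thesis using p(2) q'(2) q'x \<open>p x = h\<close> by metis
    qed (use that p3 in blast)
    then show "p \<in> {p \<in> pairings H. \<forall>z\<in>H - (U - {h, x}). p z = q' z}"
      using p(1) by blast
  next
    fix p assume "p \<in> {p \<in> pairings H. \<forall>z\<in>H - (U - {h, x}). p z = q' z}"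
    then have p: "p \<in> pairings H" and eq: "\<And>z. z \<in> H - (U - {h, x}) \<Longrightarrow> p z = q' z"
      by simp_all
    have "p h = x" using eq[of h] h U q' by blast
    moreover have "p z = q z" if "z \<in> H - U" for z
    proof -
      have "p z = q' z" using eq that by blast
      also have "\<dots> = q z" using q'(1) that P by blast
      finally show ?thesis .
    qed
    ultimately show "p \<in> {p \<in> P. p h = x}" using P p by blast
  qed
  ultimately show ?thesis using q'H U unfolding cylinder_def by blast
qed

lemma card_cylinder:
  assumes cyl: "cylinder H U P" and fin: "finite H" and h: "h \<in> U" and x: "x \<in> U - {h}"
  shows "real (card P) = (real (card U) - 1) * real (card {p \<in> P. p h = x})"
proof -
  have finP: "finite P"
    using finite_subset[OF cylinder_subset[OF cyl] finite_pairings[OF fin]] .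
  have finU: "finite U" using cyl fin finite_subset by (auto simp: cylinder_def)
  have sub: "(\<lambda>p. p h) ` P \<subseteq> U - {h}"
    by (rule partner_in_remaining[OF cyl h])
  have "card P = (\<Sum>p\<in>P. 1)" by simp
  also have "\<dots> = (\<Sum>y\<in>U - {h}. \<Sum>p\<in>{p \<in> P. p h = y}. 1)"
    by (rule sum.group[symmetric]) (use finP finU sub in auto)
  also have "\<dots> = (\<Sum>y\<in>U - {h}. card {p \<in> P. p h = x})"
    by (intro sum.cong) (auto simp: card_partner_fibre[OF cyl h _ x])
  also have "\<dots> = (card U - 1) * card {p \<in> P. p h = x}" using h finU by simp
  finally have "card P = (card U - 1) * card {p \<in> P. p h = x}" .
  moreover have "card U \<ge> 1" using h finU by (metis One_nat_def Suc_leI card_gt_0_iff empty_iff)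
  ultimately show ?thesis by (simp add: of_nat_diff)
qed

lemma sum_cylinder:
  fixes f :: "(half_edge \<Rightarrow> half_edge) \<Rightarrow> real"
  assumes cyl: "cylinder H U P" and fin: "finite H" and h: "h \<in> U"
  shows "sum f P = (\<Sum>x\<in>U - {h}. \<Sum>p\<in>{p \<in> P. p h = x}. f p)"
proof (rule sum.group[symmetric])
  show "finite P"
    using finite_subset[OF cylinder_subset[OF cyl] finite_pairings[OF fin]] .
  show "finite (U - {h})" using cyl fin finite_subset by (auto simp: cylinder_def)
  show "(\<lambda>p. p h) ` P \<subseteq> U - {h}"
    by (rule partner_in_remaining[OF cyl h])
qed

text \<open>
  The form in which one step of the exploration is used: a bound on the conditional means given
  the partner of \<open>h\<close> carries over to the mean, except that partners in the bad set \<open>B\<close>, which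
  have probability at most \<open>\<beta>\<close>, only obey the trivial bound \<open>K\<close>.
\<close>

lemma sum_cylinder_le:
  fixes f :: "(half_edge \<Rightarrow> half_edge) \<Rightarrow> real" and K \<epsilon> \<beta> :: real
  assumes cyl: "cylinder H U P" and fin: "finite H" and h: "h \<in> U"
    and fK: "\<And>p. p \<in> P \<Longrightarrow> f p \<le> K" and K: "0 \<le> K" and \<epsilon>: "0 \<le> \<epsilon>"
    and good: "\<And>x. x \<in> U - {h} - B \<Longrightarrow>
          (\<Sum>p\<in>{p \<in> P. p h = x}. f p) \<le> \<epsilon> * card {p \<in> P. p h = x}"
    and B: "finite B" "real (card B) \<le> \<beta> * (real (card U) - 1)"
  shows "sum f P \<le> (\<epsilon> + K * \<beta>) * card P"
proof (cases "U - {h} = {}")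
  case True
  then have "P = {}" using partner_in_remaining[OF cyl h] by blast
  then show ?thesis by simp
next
  case False
  then obtain y where y: "y \<in> U - {h}" by blast
  define N where "N = real (card {p \<in> P. p h = y})"
  have N: "real (card {p \<in> P. p h = x}) = N" if "x \<in> U - {h}" for x
    using card_partner_fibre[OF cyl h that y] by (simp add: N_def)
  have N0: "0 \<le> N" by (simp add: N_def)
  have cP: "real (card P) = (real (card U) - 1) * N"
    unfolding N_def by (rule card_cylinder[OF cyl fin h y])
  have finU: "finite U" using cyl fin finite_subset by (auto simp: cylinder_def)
  have cU: "real (card (U - {h})) = real (card U) - 1"
    using h finU card_gt_0_iff[of U] by (subst card_Diff_singleton) (auto simp: of_nat_diff Suc_leI)
  have "sum f P = (\<Sum>x\<in>U - {h}. \<Sum>p\<in>{p \<in> P. p h = x}. f p)"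
    by (rule sum_cylinder[OF cyl fin h])
  also have "\<dots> \<le> (\<Sum>x\<in>U - {h}. \<epsilon> * N + (if x \<in> B then K * N else 0))"
  proof (rule sum_mono)
    fix x assume x: "x \<in> U - {h}"
    show "(\<Sum>p\<in>{p \<in> P. p h = x}. f p) \<le> \<epsilon> * N + (if x \<in> B then K * N else 0)"
    proof (cases "x \<in> B")
      case True
      have "(\<Sum>p\<in>{p \<in> P. p h = x}. f p) \<le> real (card {p \<in> P. p h = x}) * K"
        by (rule sum_bounded_above) (use fK in auto)
      moreover have "0 \<le> \<epsilon> * N" using \<epsilon> N0 by simp
      ultimately show ?thesis using True N[OF x] by (simp add: mult.commute)
    next
      case False
      then show ?thesis using good[of x] x N[OF x] by simp
    qed
  qed
  also have "\<dots> = (real (card U) - 1) * (\<epsilon> * N) + K * N * card ((U - {h}) \<inter> B)"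
    using finU cU by (simp add: sum.distrib sum.If_cases Int_def mult.commute)
  also have "\<dots> \<le> (real (card U) - 1) * (\<epsilon> * N) + K * N * (\<beta> * (real (card U) - 1))"
  proof -
    have "real (card ((U - {h}) \<inter> B)) \<le> real (card B)" by (simp add: card_mono B)
    then show ?thesis using B K N0 by (intro add_left_mono mult_left_mono) auto
  qed
  also have "\<dots> = (\<epsilon> + K * \<beta>) * card P" unfolding cP by (simp add: algebra_simps)
  finally show ?thesis .
qed

lemma abs_sum_cylinder_le:
  fixes f :: "(half_edge \<Rightarrow> half_edge) \<Rightarrow> real" and K \<epsilon> \<beta> :: real
  assumes cyl: "cylinder H U P" and fin: "finite H" and h: "h \<in> U"
    and fK: "\<And>p. p \<in> P \<Longrightarrow> \<bar>f p\<bar> \<le> K" and K: "0 \<le> K" and \<epsilon>: "0 \<le> \<epsilon>"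
    and good: "\<And>x. x \<in> U - {h} - B \<Longrightarrow>
          \<bar>\<Sum>p\<in>{p \<in> P. p h = x}. f p\<bar> \<le> \<epsilon> * card {p \<in> P. p h = x}"
    and B: "finite B" "real (card B) \<le> \<beta> * (real (card U) - 1)"
  shows "\<bar>sum f P\<bar> \<le> (\<epsilon> + K * \<beta>) * card P"
proof (rule abs_leI)
  show "sum f P \<le> (\<epsilon> + K * \<beta>) * card P"
    by (rule sum_cylinder_le[OF cyl fin h abs_le_D1[OF fK] K \<epsilon> abs_le_D1[OF good] B])
  have good': "(\<Sum>p\<in>{p \<in> P. p h = x}. - f p) \<le> \<epsilon> * card {p \<in> P. p h = x}"
    if "x \<in> U - {h} - B" for x
    using abs_le_D2[OF good[OF that]] by (simp only: sum_negf)
  have "sum (\<lambda>p. - f p) P \<le> (\<epsilon> + K * \<beta>) * card P"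
    by (rule sum_cylinder_le[OF cyl fin h abs_le_D2[OF fK] K \<epsilon> good' B])
  then show "- sum f P \<le> (\<epsilon> + K * \<beta>) * card P" by (simp only: sum_negf)
qed

section \<open>Decorrelation of non-backtracking walks\<close>

definition nb_step ::
  "half_edge set \<Rightarrow> (half_edge \<Rightarrow> half_edge) \<Rightarrow> (half_edge \<Rightarrow> real) \<Rightarrow> half_edge \<Rightarrow> real" where
  "nb_step H p \<phi> h =
     (\<Sum>h'\<in>incident H (fst (p h)) - {h, p h}. \<phi> h') / card (incident H (fst (p h)) - {h, p h})"

text \<open>
  The mean of \<open>g\<close> at the half-edge through which the walk arrives after leaving through \<open>h\<close> and
  making \<open>l\<close> further steps.
\<close>

definition nb_mean ::
  "half_edge set \<Rightarrow> (half_edge \<Rightarrow> real) \<Rightarrow> nat \<Rightarrow> (half_edge \<Rightarrow> half_edge) \<Rightarrow> half_edge \<Rightarrow> real" where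
  "nb_mean H g l p = (nb_step H p ^^ l) (\<lambda>h. g (p h))"

lemma nb_mean_0 [simp]: "nb_mean H g 0 p h = g (p h)"
  by (simp add: nb_mean_def)

lemma nb_mean_Suc: "nb_mean H g (Suc l) p h = nb_step H p (nb_mean H g l p) h"
  by (simp add: nb_mean_def)

lemma incident_subset: "incident H i \<subseteq> H"
  by (auto simp: incident_def)

lemma self_incident: "h \<in> H \<Longrightarrow> h \<in> incident H (fst h)"
  by (simp add: incident_def)

lemma abs_mean_le:
  fixes f :: "'a \<Rightarrow> real"
  assumes "\<And>x. x \<in> A \<Longrightarrow> \<bar>f x\<bar> \<le> c" and "0 \<le> c"
  shows "\<bar>sum f A / card A\<bar> \<le> c"
proof (cases "card A = 0")
  case False
  have "\<bar>sum f A\<bar> \<le> (\<Sum>x\<in>A. \<bar>f x\<bar>)" by (rule sum_abs)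
  also have "\<dots> \<le> card A * c" using sum_bounded_above[of A "\<lambda>x. \<bar>f x\<bar>" c] assms(1) by simp
  finally show ?thesis using False by (simp add: field_simps)
qed (use assms in simp)

text \<open>
  \<open>R\<close> bounds the number of half-edges that may be revealed, and \<open>\<beta>\<close> bounds the probability that a
  uniform unpaired half-edge is attached to one of the vertices of these half-edges, or of the
  at most two half-edges through which the walks are about to leave.
\<close>

locale centred_walk =
  fixes H :: "half_edge set" and M :: nat and g :: "half_edge \<Rightarrow> real" and K \<beta> :: real and R :: nat
  assumes fin: "finite H"
    and deg: "h \<in> H \<Longrightarrow> 3 \<le> degree H (fst h)" "h \<in> H \<Longrightarrow> degree H (fst h) \<le> M"
    and g_le: "h \<in> H \<Longrightarrow> \<bar>g h\<bar> \<le> K"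
    and g_centred: "sum g H = 0"
    and K0: "0 \<le> K" and \<beta>0: "0 \<le> \<beta>"
    and \<beta>: "real M * (real R + 2) \<le> \<beta> * (real (card H) - R - 1)"
begin

abbreviation "F \<equiv> nb_mean H g"

text \<open>
  For \<open>Y\<close> the half-edges already in use, these are the partners at which the walk would meet an
  old vertex.
\<close>

definition near :: "half_edge set \<Rightarrow> half_edge set" where
  "near Y = {x \<in> H. fst x \<in> fst ` Y}"

lemma finite_near [simp]: "finite (near Y)"
  by (simp add: near_def fin)

lemma card_near:
  assumes "Y \<subseteq> H"
  shows "card (near Y) \<le> M * card Y"
proof -
  have fY: "finite Y" using assms fin finite_subset by blast
  have "near Y = (\<Union>y\<in>Y. incident H (fst y))" by (auto simp: near_def incident_def)
  then have "card (near Y) \<le> (\<Sum>y\<in>Y. card (incident H (fst y)))"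
    using card_UN_le[OF fY] by simp
  also have "\<dots> \<le> (\<Sum>y\<in>Y. M)"
    using deg(2) assms by (intro sum_mono) (auto simp: degree_def)
  finally show ?thesis by (simp add: mult.commute)
qed

lemma F_le:
  assumes "p \<in> pairings H"
  shows "h \<in> H \<Longrightarrow> \<bar>F l p h\<bar> \<le> K"
proof (induction l arbitrary: h)
  case 0
  then show ?case using g_le pairingsD(2)[OF assms] by simp
next
  case (Suc l)
  show ?case unfolding nb_mean_Suc nb_step_def
    by (rule abs_mean_le) (use Suc.IH incident_subset K0 in blast)+
qed

lemma F_mult_le:
  assumes "cylinder H U P" "p \<in> P" "h \<in> H" "h' \<in> H"
  shows "\<bar>F l p h * F l' p h'\<bar> \<le> K\<^sup>2"
proof -
  have "p \<in> pairings H" using assms cylinder_subset by blast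
  from mult_mono[OF F_le[OF this assms(3)] F_le[OF this assms(4)] K0 abs_ge_zero]
  show ?thesis by (simp add: abs_mult power2_eq_square)
qed

lemma cylinder_facts:
  assumes cyl: "cylinder H U P" and R: "card (H - U) \<le> R"
  shows "U \<subseteq> H" "finite U" "M * (real (card (H - U)) + 2) \<le> \<beta> * (real (card U) - 1)"
proof -
  show U: "U \<subseteq> H" using cyl by (simp add: cylinder_def)
  then show fU: "finite U" using fin finite_subset by blast
  have "card H = card U + card (H - U)"
    using U fU fin by (simp add: card_Diff_subset card_mono)
  then have "\<beta> * (real (card H) - R - 1) \<le> \<beta> * (real (card U) - 1)"
    using R \<beta>0 by (intro mult_left_mono) auto
  moreover have "M * (real (card (H - U)) + 2) \<le> real M * (real R + 2)"
    using R by (intro mult_left_mono) auto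
  ultimately show "M * (real (card (H - U)) + 2) \<le> \<beta> * (real (card U) - 1)" using \<beta> by linarith
qed

lemma near_small:
  assumes cyl: "cylinder H U P" and R: "card (H - U) \<le> R"
    and Y: "Y \<subseteq> H" "card Y \<le> card (H - U) + 2"
  shows "real (card (near Y)) \<le> \<beta> * (real (card U) - 1)"
proof -
  have "M * card Y \<le> M * (card (H - U) + 2)" using Y(2) by (rule mult_le_mono2)
  with card_near[OF Y(1)] have "card (near Y) \<le> M * (card (H - U) + 2)" by (rule le_trans)
  then have "real (card (near Y)) \<le> real (M * (card (H - U) + 2))" by (simp only: of_nat_le_iff)
  also have "\<dots> = M * (real (card (H - U)) + 2)" by (simp add: algebra_simps)
  finally show ?thesis using cylinder_facts(3)[OF cyl R] by linarith
qed

lemma card_remaining: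
  assumes "U \<subseteq> H" "h \<in> U" "x \<in> U - {h}"
  shows "card (H - (U - {h, x})) = card (H - U) + 2"
proof -
  have "H - (U - {h, x}) = insert h (insert x (H - U))" "h \<notin> insert x (H - U)" "x \<notin> H - U"
    using assms by auto
  then show ?thesis using fin by simp
qed

text \<open>
  If the partner \<open>x\<close> of \<open>h\<close> is attached to a vertex not seen before, the walk continues through one
  of at least two half-edges that are all still unpaired.
\<close>

lemma fresh_vertex:
  assumes U: "U \<subseteq> H" and h: "h \<in> U" and Y: "(H - U) \<union> {h} \<subseteq> Y"
    and x: "x \<in> U - {h} - near Y"
  defines "A \<equiv> incident H (fst x) - {h, x}"
  shows "A \<subseteq> U - {h, x} - Y" "2 \<le> card A" "finite A"
proof -
  have xY: "fst x \<notin> fst ` Y" and xH: "x \<in> H" using x U by (auto simp: near_def)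
  have notY: "y \<notin> Y" if "y \<in> incident H (fst x)" for y
    using that xY by (auto simp: incident_def image_iff)
  then show "A \<subseteq> U - {h, x} - Y" using Y incident_subset[of H "fst x"] by (auto simp: A_def)
  have "A = incident H (fst x) - {x}" using notY[of h] Y by (auto simp: A_def)
  then have "card A = degree H (fst x) - 1"
    using self_incident[OF xH] fin incident_subset[of H "fst x"]
    by (simp add: degree_def finite_subset)
  then show "2 \<le> card A" using deg(1)[OF xH] by simp
  show "finite A" using fin incident_subset[of H "fst x"] by (simp add: A_def finite_subset)
qed

lemma fibre_mean_le:
  fixes c :: real
  assumes "\<And>y. y \<in> A \<Longrightarrow> \<bar>\<Sum>p\<in>Q. f p y\<bar> \<le> c" and "0 \<le> c"
  shows "\<bar>\<Sum>p\<in>Q. (\<Sum>y\<in>A. f p y) / real (card A)\<bar> \<le> c"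
proof -
  have "(\<Sum>p\<in>Q. (\<Sum>y\<in>A. f p y) / real (card A)) = (\<Sum>y\<in>A. \<Sum>p\<in>Q. f p y) / real (card A)"
    by (simp add: sum_divide_distrib[symmetric] sum.swap[of _ A])
  then show ?thesis using abs_mean_le[OF assms] by simp
qed

text \<open>
  The partner of \<open>h\<close> is uniform on \<open>U - {h}\<close>.  As \<open>g\<close> sums to \<open>0\<close> over \<open>H\<close>, its sum over
  \<open>U - {h}\<close> is minus its sum over the few remaining half-edges.
\<close>

lemma sum_g_le:
  assumes cyl: "cylinder H U P" and h: "h \<in> U" and R: "card (H - U) \<le> R"
  shows "\<bar>\<Sum>p\<in>P. g (p h)\<bar> \<le> K * \<beta> * card P"
proof (cases "U - {h} = {}")
  case True
  then have "P = {}" using partner_in_remaining[OF cyl h] by blast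
  then show ?thesis by simp
next
  case False
  then obtain y where y: "y \<in> U - {h}" by blast
  note U = cylinder_facts[OF cyl R]
  define N where "N = real (card {p \<in> P. p h = y})"
  have "(\<Sum>p\<in>P. g (p h)) = (\<Sum>x\<in>U - {h}. \<Sum>p\<in>{p \<in> P. p h = x}. g (p h))"
    by (rule sum_cylinder[OF cyl fin h])
  also have "\<dots> = (\<Sum>x\<in>U - {h}. N * g x)"
    by (intro sum.cong) (auto simp: N_def card_partner_fibre[OF cyl h _ y])
  also have "\<dots> = N * sum g (U - {h})" by (simp add: sum_distrib_left)
  also have "sum g (U - {h}) = - sum g (insert h (H - U))"
  proof -
    have "H = (U - {h}) \<union> insert h (H - U)" using U h by auto
    moreover have "(U - {h}) \<inter> insert h (H - U) = {}" by auto
    ultimately have "sum g H = sum g (U - {h}) + sum g (insert h (H - U))"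
      using sum.union_disjoint[of "U - {h}" "insert h (H - U)" g] U(2) fin by auto
    then show ?thesis using g_centred by simp
  qed
  also have "\<bar>N * - sum g (insert h (H - U))\<bar> \<le> N * (K * (real (card (H - U)) + 1))"
  proof -
    have "\<bar>sum g (insert h (H - U))\<bar> \<le> (\<Sum>x\<in>insert h (H - U). \<bar>g x\<bar>)" by (rule sum_abs)
    also have "\<dots> \<le> card (insert h (H - U)) * K"
      by (rule sum_bounded_above) (use g_le U h in auto)
    also have "\<dots> = K * (real (card (H - U)) + 1)" using h fin by simp
    finally show ?thesis by (simp add: abs_mult N_def mult_left_mono)
  qed
  also have "\<dots> \<le> N * (K * (\<beta> * (real (card U) - 1)))"
  proof -
    have "h \<in> H" using h U by blast
    then have "1 \<le> real M" using deg[of h] by simp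
    then have "1 * (real (card (H - U)) + 1) \<le> M * (real (card (H - U)) + 2)"
      by (intro mult_mono) auto
    then show ?thesis using U(3) K0 by (intro mult_left_mono) (auto simp: N_def)
  qed
  also have "\<dots> = K * \<beta> * card P"
    unfolding card_cylinder[OF cyl fin h y] N_def by (simp add: algebra_simps)
  finally show ?thesis .
qed

lemma one_walk:
  assumes "cylinder H U P" "h \<in> U" "card (H - U) + 2 * l \<le> R"
  shows "\<bar>\<Sum>p\<in>P. F l p h\<bar> \<le> (real l + 1) * (K * \<beta>) * card P"
  using assms
proof (induction l arbitrary: U P h)
  case 0
  then show ?case using sum_g_le[of U P h] by simp
next
  case (Suc l)
  note cyl = Suc.prems(1) and h = Suc.prems(2)
  have R: "card (H - U) \<le> R" using Suc.prems(3) by simp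
  note U = cylinder_facts[OF cyl R]
  let ?Y = "insert h (H - U)"
  have "\<bar>\<Sum>p\<in>P. F (Suc l) p h\<bar> \<le> ((real l + 1) * (K * \<beta>) + K * \<beta>) * card P"
  proof (rule abs_sum_cylinder_le[OF cyl fin h _ K0, where B = "near ?Y"])
    show "\<bar>F (Suc l) p h\<bar> \<le> K" if "p \<in> P" for p
      using that F_le cylinder_subset[OF cyl] h U(1) by blast
    show "0 \<le> (real l + 1) * (K * \<beta>)" using K0 \<beta>0 by simp
    show "real (card (near ?Y)) \<le> \<beta> * (real (card U) - 1)"
      by (rule near_small[OF cyl R]) (use h U(1) fin in auto)
  next
    fix x assume x: "x \<in> U - {h} - near ?Y"
    let ?Q = "{p \<in> P. p h = x}" and ?A = "incident H (fst x) - {h, x}"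
    have xU: "x \<in> U - {h}" using x by blast
    note A = fresh_vertex[OF U(1) h _ x]
    have AU: "?A \<subseteq> U - {h, x}" using A(1) by auto
    have "\<bar>\<Sum>p\<in>?Q. (\<Sum>y\<in>?A. F l p y) / real (card ?A)\<bar> \<le> (real l + 1) * (K * \<beta>) * card ?Q"
    proof (rule fibre_mean_le)
      show "\<bar>\<Sum>p\<in>?Q. F l p y\<bar> \<le> (real l + 1) * (K * \<beta>) * card ?Q" if "y \<in> ?A" for y
        by (rule Suc.IH[OF cylinder_reveal[OF cyl h xU]])
          (use that AU card_remaining[OF U(1) h xU] Suc.prems(3) in auto)
    qed (use K0 \<beta>0 in simp)
    also have "(\<Sum>p\<in>?Q. (\<Sum>y\<in>?A. F l p y) / real (card ?A)) = (\<Sum>p\<in>?Q. F (Suc l) p h)"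
      by (intro sum.cong) (auto simp: nb_mean_Suc nb_step_def)
    finally show "\<bar>\<Sum>p\<in>?Q. F (Suc l) p h\<bar> \<le> (real l + 1) * (K * \<beta>) * card ?Q" .
  qed simp
  then show ?case by (simp add: algebra_simps)
qed

text \<open>
  The first walk is followed to its end, at which point \<open>one_walk\<close> applies to the second one.  The
  bad set contains the neighbourhood of \<open>h'\<close>, so that the first walk does not use up the half-edge
  through which the second one leaves.
\<close>

lemma two_walks:
  assumes "cylinder H U P" "h \<in> U" "h' \<in> U" "h \<noteq> h'" "card (H - U) + 2 * l + 2 * l' + 2 \<le> R"
  shows "\<bar>\<Sum>p\<in>P. F l p h * F l' p h'\<bar> \<le> (real l + real l' + 2) * (K\<^sup>2 * \<beta>) * card P"
  using assms
proof (induction l arbitrary: U P h)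
  case (0 U P h)
  note cyl = "0.prems"(1) and h = "0.prems"(2) and h' = "0.prems"(3)
  have R: "card (H - U) \<le> R" using "0.prems"(5) by simp
  note U = cylinder_facts[OF cyl R]
  let ?Y = "insert h' (insert h (H - U))"
  have hH: "h \<in> H" "h' \<in> H" using h h' U(1) by auto
  have "\<bar>\<Sum>p\<in>P. F 0 p h * F l' p h'\<bar> \<le> ((real l' + 1) * (K\<^sup>2 * \<beta>) + K\<^sup>2 * \<beta>) * card P"
  proof (rule abs_sum_cylinder_le[OF cyl fin h, where B = "near ?Y"])
    show "\<bar>F 0 p h * F l' p h'\<bar> \<le> K\<^sup>2" if "p \<in> P" for p
      by (rule F_mult_le[OF cyl that hH])
    show "0 \<le> (real l' + 1) * (K\<^sup>2 * \<beta>)" using \<beta>0 by simp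
    show "real (card (near ?Y)) \<le> \<beta> * (real (card U) - 1)"
      by (rule near_small[OF cyl R]) (use h h' hH fin \<open>h \<noteq> h'\<close> in auto)
  next
    fix x assume x: "x \<in> U - {h} - near ?Y"
    let ?Q = "{p \<in> P. p h = x}"
    have xU: "x \<in> U - {h}" and xH: "x \<in> H" using x U(1) by auto
    have "x \<noteq> h'" using x hH by (auto simp: near_def)
    then have h'U: "h' \<in> U - {h, x}" using h' \<open>h \<noteq> h'\<close> by auto
    have "(\<Sum>p\<in>?Q. F 0 p h * F l' p h') = g x * (\<Sum>p\<in>?Q. F l' p h')"
      by (simp add: sum_distrib_left)
    also have "\<bar>\<dots>\<bar> \<le> K * ((real l' + 1) * (K * \<beta>) * card ?Q)"
      unfolding abs_mult
      by (intro mult_mono g_le xH one_walk[OF cylinder_reveal[OF cyl h xU] h'U])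
        (use "0.prems"(5) card_remaining[OF U(1) h xU] K0 in auto)
    finally show "\<bar>\<Sum>p\<in>?Q. F 0 p h * F l' p h'\<bar> \<le> (real l' + 1) * (K\<^sup>2 * \<beta>) * card ?Q"
      by (simp add: power2_eq_square mult_ac)
  qed simp_all
  then show ?case by (simp add: algebra_simps)
next
  case (Suc l U P h)
  note cyl = Suc.prems(1) and h = Suc.prems(2) and h' = Suc.prems(3)
  have R: "card (H - U) \<le> R" using Suc.prems(5) by simp
  note U = cylinder_facts[OF cyl R]
  let ?Y = "insert h' (insert h (H - U))" and ?\<epsilon> = "(real l + real l' + 2) * (K\<^sup>2 * \<beta>)"
  have hH: "h \<in> H" "h' \<in> H" using h h' U(1) by auto
  have "\<bar>\<Sum>p\<in>P. F (Suc l) p h * F l' p h'\<bar> \<le> (?\<epsilon> + K\<^sup>2 * \<beta>) * card P"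
  proof (rule abs_sum_cylinder_le[OF cyl fin h, where B = "near ?Y"])
    show "\<bar>F (Suc l) p h * F l' p h'\<bar> \<le> K\<^sup>2" if "p \<in> P" for p
      by (rule F_mult_le[OF cyl that hH])
    show "0 \<le> ?\<epsilon>" using \<beta>0 by simp
    show "real (card (near ?Y)) \<le> \<beta> * (real (card U) - 1)"
      by (rule near_small[OF cyl R]) (use h h' hH fin \<open>h \<noteq> h'\<close> in auto)
  next
    fix x assume x: "x \<in> U - {h} - near ?Y"
    let ?Q = "{p \<in> P. p h = x}" and ?A = "incident H (fst x) - {h, x}"
    have xU: "x \<in> U - {h}" using x by blast
    have "x \<noteq> h'" using x hH by (auto simp: near_def)
    then have h'U: "h' \<in> U - {h, x}" using h' \<open>h \<noteq> h'\<close> by auto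
    have "(H - U) \<union> {h} \<subseteq> ?Y" by auto
    note A = fresh_vertex[OF U(1) h this x]
    have "\<bar>\<Sum>p\<in>?Q. (\<Sum>y\<in>?A. F l p y * F l' p h') / real (card ?A)\<bar> \<le> ?\<epsilon> * card ?Q"
    proof (rule fibre_mean_le)
      fix y assume y: "y \<in> ?A"
      show "\<bar>\<Sum>p\<in>?Q. F l p y * F l' p h'\<bar> \<le> ?\<epsilon> * card ?Q"
      proof (rule Suc.IH[OF cylinder_reveal[OF cyl h xU] _ h'U])
        show "y \<in> U - {h, x}" "y \<noteq> h'" using y A(1) by auto
      qed (use card_remaining[OF U(1) h xU] Suc.prems(5) in simp)
    qed (use \<beta>0 in simp)
    also have "(\<Sum>p\<in>?Q. (\<Sum>y\<in>?A. F l p y * F l' p h') / real (card ?A)) =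
        (\<Sum>p\<in>?Q. F (Suc l) p h * F l' p h')"
      by (intro sum.cong) (auto simp: nb_mean_Suc nb_step_def sum_distrib_right)
    finally show "\<bar>\<Sum>p\<in>?Q. F (Suc l) p h * F l' p h'\<bar> \<le> ?\<epsilon> * card ?Q" .
  qed simp_all
  then show ?case by (simp add: algebra_simps)
qed

text \<open>
  At a new vertex with \<open>a \<ge> 2\<close> ways to continue, the square of a mean of \<open>a\<close> terms has \<open>a\<close> diagonal
  terms among \<open>a\<^sup>2\<close>.  Hence the bound \<open>v\<close> for \<open>l\<close> steps turns into \<open>v / 2\<close> plus the correlation of
  two different continuations plus the bad event.
\<close>

lemma second_moment:
  assumes "cylinder H U P" "h \<in> U" "card (H - U) + 4 * l \<le> R"
  shows "(\<Sum>p\<in>P. (F l p h)\<^sup>2) \<le> (K\<^sup>2 / 2 ^ l + 2 * (2 * real l + 1) * (K\<^sup>2 * \<beta>)) * card P"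
  using assms
proof (induction l arbitrary: U P h)
  case 0
  note cyl = "0.prems"(1)
  have hH: "h \<in> H" using "0.prems" by (auto simp: cylinder_def)
  have "(\<Sum>p\<in>P. (F 0 p h)\<^sup>2) \<le> of_nat (card P) * K\<^sup>2"
  proof (rule sum_bounded_above)
    show "(F 0 p h)\<^sup>2 \<le> K\<^sup>2" if "p \<in> P" for p
      using F_mult_le[OF cyl that hH hH, of 0 0] by (simp add: power2_eq_square)
  qed
  also have "\<dots> \<le> (K\<^sup>2 / 2 ^ 0 + 2 * (2 * real 0 + 1) * (K\<^sup>2 * \<beta>)) * card P"
    using \<beta>0 by (simp add: algebra_simps)
  finally show ?case .
next
  case (Suc l)
  note cyl = Suc.prems(1) and h = Suc.prems(2)
  have R: "card (H - U) \<le> R" using Suc.prems(3) by simp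
  note U = cylinder_facts[OF cyl R]
  have hH: "h \<in> H" using h U(1) by auto
  let ?Y = "insert h (H - U)"
  define v where "v = K\<^sup>2 / 2 ^ l + 2 * (2 * real l + 1) * (K\<^sup>2 * \<beta>)"
  define \<delta> where "\<delta> = (real l + real l + 2) * (K\<^sup>2 * \<beta>)"
  have v0: "0 \<le> v" and \<delta>0: "0 \<le> \<delta>" using \<beta>0 by (simp_all add: v_def \<delta>_def)
  have "(\<Sum>p\<in>P. (F (Suc l) p h)\<^sup>2) \<le> ((v / 2 + \<delta>) + K\<^sup>2 * \<beta>) * card P"
  proof (rule sum_cylinder_le[OF cyl fin h, where B = "near ?Y"])
    show "(F (Suc l) p h)\<^sup>2 \<le> K\<^sup>2" if "p \<in> P" for p
      using F_mult_le[OF cyl that hH hH, of "Suc l" "Suc l"] by (simp add: power2_eq_square)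
    show "0 \<le> v / 2 + \<delta>" using v0 \<delta>0 by simp
    show "real (card (near ?Y)) \<le> \<beta> * (real (card U) - 1)"
      by (rule near_small[OF cyl R]) (use h U(1) fin in auto)
  next
    fix x assume x: "x \<in> U - {h} - near ?Y"
    let ?Q = "{p \<in> P. p h = x}" and ?A = "incident H (fst x) - {h, x}"
    have xU: "x \<in> U - {h}" using x by blast
    have "(H - U) \<union> {h} \<subseteq> ?Y" by auto
    note A = fresh_vertex[OF U(1) h this x]
    have AU: "?A \<subseteq> U - {h, x}" using A(1) by auto
    have rem: "card (H - (U - {h, x})) = card (H - U) + 2" by (rule card_remaining[OF U(1) h xU])
    define a and N where "a = real (card ?A)" and "N = real (card ?Q)"
    have a2: "2 \<le> a" and N0: "0 \<le> N" using A(2) by (simp_all add: a_def N_def)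
    \<comment> \<open>both walks take the same half-edge, or they separate here\<close>
    have diag: "(\<Sum>p\<in>?Q. (F l p y)\<^sup>2) \<le> v * N" if "y \<in> ?A" for y
      unfolding v_def N_def
      by (rule Suc.IH[OF cylinder_reveal[OF cyl h xU]]) (use that AU rem Suc.prems(3) in auto)
    have off: "(\<Sum>p\<in>?Q. F l p y * F l p z) \<le> \<delta> * N" if "y \<in> ?A" "z \<in> ?A" "y \<noteq> z" for y z
      unfolding \<delta>_def N_def
      by (rule abs_le_D1[OF two_walks[OF cylinder_reveal[OF cyl h xU]]])
        (use that AU rem Suc.prems(3) in auto)
    have "(\<Sum>p\<in>?Q. (F (Suc l) p h)\<^sup>2) = (\<Sum>p\<in>?Q. (\<Sum>y\<in>?A. \<Sum>z\<in>?A. F l p y * F l p z) / a\<^sup>2)"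
      by (intro sum.cong)
        (auto simp: nb_mean_Suc nb_step_def power_divide a_def sum_product power2_eq_square)
    also have "\<dots> = (\<Sum>y\<in>?A. \<Sum>z\<in>?A. \<Sum>p\<in>?Q. F l p y * F l p z) / a\<^sup>2"
      by (simp add: sum_divide_distrib[symmetric] sum.swap[of _ ?A ?Q])
    also have "\<dots> \<le> (\<Sum>y\<in>?A. \<Sum>z\<in>?A. (if y = z then v * N else 0) + \<delta> * N) / a\<^sup>2"
    proof (intro divide_right_mono sum_mono)
      fix y z assume yz: "y \<in> ?A" "z \<in> ?A"
      have "0 \<le> \<delta> * N" using \<delta>0 N0 by simp
      then show "(\<Sum>p\<in>?Q. F l p y * F l p z) \<le> (if y = z then v * N else 0) + \<delta> * N"
        using diag[of y] off[of y z] yz by (auto simp: power2_eq_square)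
    qed simp
    also have "\<dots> = (a * (v * N) + a\<^sup>2 * (\<delta> * N)) / a\<^sup>2"
      using A(3) by (simp add: sum.distrib a_def[symmetric] power2_eq_square algebra_simps del: card_Diff_insert)
    also have "\<dots> = v * N / a + \<delta> * N" using a2 by (simp add: field_simps power2_eq_square)
    also have "\<dots> \<le> v * N / 2 + \<delta> * N"
      using a2 v0 N0 by (intro add_right_mono divide_left_mono) auto
    finally show "(\<Sum>p\<in>?Q. (F (Suc l) p h)\<^sup>2) \<le> (v / 2 + \<delta>) * real (card ?Q)"
      by (simp add: N_def algebra_simps)
  qed simp_all
  also have "\<dots> \<le> (K\<^sup>2 / 2 ^ Suc l + 2 * (2 * real (Suc l) + 1) * (K\<^sup>2 * \<beta>)) * card P"
  proof (rule mult_right_mono)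
    have "0 \<le> K\<^sup>2 * \<beta>" using \<beta>0 by simp
    then show "v / 2 + \<delta> + K\<^sup>2 * \<beta> \<le>
        K\<^sup>2 / 2 ^ Suc l + 2 * (2 * real (Suc l) + 1) * (K\<^sup>2 * \<beta>)"
      unfolding v_def \<delta>_def by (simp add: algebra_simps)
  qed simp
  finally show ?case .
qed

end

section \<open>The second moment of the friendship bias\<close>

lemma nb_step_set_nonempty:
  assumes "3 \<le> degree H v"
  shows "incident H v - {h, h'} \<noteq> {}"
proof
  assume "incident H v - {h, h'} = {}"
  then have "incident H v \<subseteq> {h, h'}" by blast
  then have "degree H v \<le> card {h, h'}" unfolding degree_def by (intro card_mono) auto
  also have "\<dots> \<le> 2" using card_insert_le_m1[of 2 "{h'}" h] by simp
  finally show False using assms by simp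
qed

text \<open>
  The law of the walk grows at its end, whereas the exploration conditions on its first step; both
  iterate the same averaging operator.
\<close>

lemma expectation_nb_half_edge:
  assumes fin: "finite H" and deg: "\<And>h. h \<in> H \<Longrightarrow> 3 \<le> degree H (fst h)"
    and p: "p \<in> pairings H" and i: "incident H i \<noteq> {}"
  shows "set_pmf (nb_half_edge H p i l) \<subseteq> H"
    and "measure_pmf.expectation (nb_half_edge H p i l) \<phi> =
      (\<Sum>h\<in>incident H i. (nb_step H p ^^ l) \<phi> h) / degree H i"
proof -
  have fin_inc: "finite (incident H j)" for j using incident_subset fin by (rule finite_subset)
  have ne: "incident H (fst (p h)) - {h, p h} \<noteq> {}" if "h \<in> H" for h
    by (rule nb_step_set_nonempty[OF deg[OF pairingsD(2)[OF p that]]])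
  have sub: "set_pmf (nb_half_edge H p i l) \<subseteq> H" for l
  proof (induction l)
    case 0
    then show ?case using i fin_inc incident_subset by simp
  next
    case (Suc l)
    have "set_pmf (pmf_of_set (incident H (fst (p h)) - {h, p h})) \<subseteq> H" if "h \<in> H" for h
      using ne[OF that] fin_inc incident_subset[of H "fst (p h)"] by auto
    then show ?case using Suc by (auto simp: subset_iff)
  qed
  show "set_pmf (nb_half_edge H p i l) \<subseteq> H" by (rule sub)
  show "measure_pmf.expectation (nb_half_edge H p i l) \<phi> =
      (\<Sum>h\<in>incident H i. (nb_step H p ^^ l) \<phi> h) / degree H i"
  proof (induction l arbitrary: \<phi>)
    case 0
    show ?case using i fin_inc by (simp add: integral_pmf_of_set degree_def)
  next
    case (Suc l)
    have "measure_pmf.expectation (nb_half_edge H p i (Suc l)) \<phi> =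
        (\<Sum>h\<in>H. pmf (nb_half_edge H p i l) h *\<^sub>R
           measure_pmf.expectation (pmf_of_set (incident H (fst (p h)) - {h, p h})) \<phi>)"
      unfolding nb_half_edge.simps
      by (rule pmf_expectation_bind[OF fin _ sub], subst set_pmf_of_set) (use ne fin_inc in auto)
    also have "\<dots> = (\<Sum>h\<in>H. pmf (nb_half_edge H p i l) h *\<^sub>R nb_step H p \<phi> h)"
      using ne fin_inc by (intro sum.cong refl) (simp add: integral_pmf_of_set nb_step_def)
    also have "\<dots> = measure_pmf.expectation (nb_half_edge H p i l) (nb_step H p \<phi>)"
      using sub by (intro integral_measure_pmf[OF fin, symmetric]) auto
    finally show ?case by (simp add: Suc.IH funpow_swap1)
  qed
qed

text \<open>
  Averages over nonempty sets preserve constants; this is what allows the degree to be centred.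
\<close>

lemma nb_mean_diff_const:
  assumes fin: "finite H" and deg: "\<And>h. h \<in> H \<Longrightarrow> 3 \<le> degree H (fst h)" and p: "p \<in> pairings H"
  shows "h \<in> H \<Longrightarrow> nb_mean H (\<lambda>h. g h - c) l p h = nb_mean H g l p h - c"
proof (induction l arbitrary: h)
  case (Suc l)
  let ?A = "incident H (fst (p h)) - {h, p h}"
  have fA: "finite ?A" using incident_subset[of H "fst (p h)"] fin finite_subset by blast
  have "?A \<noteq> {}"
    by (rule nb_step_set_nonempty[OF deg[OF pairingsD(2)[OF p Suc.prems]]])
  then have "real (card ?A) \<noteq> 0" using fA by simp
  moreover have "(\<Sum>h'\<in>?A. nb_mean H (\<lambda>h. g h - c) l p h') = (\<Sum>h'\<in>?A. nb_mean H g l p h' - c)"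
    using incident_subset[of H "fst (p h)"] by (intro sum.cong refl Suc.IH) auto
  ultimately show ?case
    by (simp add: nb_mean_Suc nb_step_def sum_subtractf diff_divide_distrib del: card_0_eq)
qed simp

lemma friendship_bias_Suc:
  fixes n :: nat and d :: "nat \<Rightarrow> nat" and c :: real
  defines "H \<equiv> half_edges n d"
  assumes deg: "\<And>i. i \<in> {1..n} \<Longrightarrow> 3 \<le> d i" and p: "p \<in> pairings H" and i: "i \<in> {1..n}"
  shows "friendship_bias n d p (Suc l) i + real (d i) - c =
    (\<Sum>h\<in>incident H i. nb_mean H (\<lambda>h. real (d (fst h)) - c) l p h) / real (d i)"
proof -
  have fin: "finite H" by (simp add: H_def)
  have fstH: "fst h \<in> {1..n}" if "h \<in> H" for h using that by (auto simp: H_def half_edges_def)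
  have degH: "3 \<le> degree H (fst h)" if "h \<in> H" for h
    using deg[OF fstH[OF that]] degree_half_edges[OF fstH[OF that], of d] by (simp add: H_def)
  have di: "degree H i = d i" using degree_half_edges[OF i] by (simp add: H_def)
  then have i0: "incident H i \<noteq> {}" using deg[OF i] by (auto simp: degree_def)
  have sub: "set_pmf (nb_half_edge H p i l) \<subseteq> H"
    by (rule expectation_nb_half_edge(1)[OF fin degH p i0])
  have fst_p: "fst (p h) \<in> {1..n}" if "h \<in> set_pmf (nb_half_edge H p i l)" for h
    using that sub by (intro fstH pairingsD(2)[OF p]) auto
  have "(\<Sum>j=1..n. nb_prob H p (Suc l) i j * real (degree H j)) =
      measure_pmf.expectation (nb_position H p i (Suc l)) (\<lambda>j. real (degree H j))"
    unfolding nb_prob_def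
    by (subst integral_measure_pmf[of "{1..n}"]) (use fst_p in auto)
  also have "\<dots> = measure_pmf.expectation (nb_half_edge H p i l) (\<lambda>h. real (degree H (fst (p h))))"
    by simp
  also have "\<dots> = measure_pmf.expectation (nb_half_edge H p i l) (\<lambda>h. real (d (fst (p h))))"
    using fst_p degree_half_edges[of _ n d]
    by (intro integral_cong_AE) (auto simp: AE_measure_pmf_iff H_def)
  also have "\<dots> = (\<Sum>h\<in>incident H i. nb_mean H (\<lambda>h. real (d (fst h))) l p h) / real (d i)"
    by (simp add: expectation_nb_half_edge(2)[OF fin degH p i0] nb_mean_def di)
  also have "\<dots> = (\<Sum>h\<in>incident H i. nb_mean H (\<lambda>h. real (d (fst h)) - c) l p h + c) / real (d i)"
    using incident_subset[of H i]
    by (intro arg_cong2[where f = "(/)"] sum.cong refl)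
      (auto simp: nb_mean_diff_const[OF fin degH p])
  also have "\<dots> = (\<Sum>h\<in>incident H i. nb_mean H (\<lambda>h. real (d (fst h)) - c) l p h) / real (d i) + c"
    using di deg[OF i] by (simp add: sum.distrib add_divide_distrib degree_def[symmetric])
  finally show ?thesis using di by (simp add: friendship_bias_def H_def[symmetric] Let_def)
qed

text \<open>
  The mean over the half-edges of \<open>i\<close> is bounded by Jensen's inequality.  Initially nothing is
  revealed.  Two walks from the same half-edge share at least their first edge, so at most \<open>4 l\<close>
  half-edges are revealed before the last of the \<open>2 l + 1\<close> edges, whence \<open>R = 4 l\<close>;
  the number of half-edges is at least \<open>3 n\<close>.
\<close>

lemma bias_second_moment:
  fixes n l M :: nat and d :: "nat \<Rightarrow> nat"
  assumes even: "even (\<Sum>i=1..n. d i)"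
    and deg: "\<And>i. i \<in> {1..n} \<Longrightarrow> 3 \<le> d i" "\<And>i. i \<in> {1..n} \<Longrightarrow> d i \<le> M"
    and l: "4 * l + 1 < 3 * n" and i: "i \<in> {1..n}"
  defines "c \<equiv> (\<Sum>i=1..n. (real (d i))\<^sup>2) / (\<Sum>i=1..n. real (d i))"
    and "\<beta> \<equiv> real M * (4 * real l + 2) / (3 * real n - 4 * real l - 1)"
  shows "measure_pmf.expectation (config_model n d)
      (\<lambda>p. (friendship_bias n d p (Suc l) i + real (d i) - c)\<^sup>2)
    \<le> (real M)\<^sup>2 / 2 ^ l + 2 * (2 * real l + 1) * ((real M)\<^sup>2 * \<beta>)"
proof -
  define H where "H = half_edges n d"
  define g where "g = (\<lambda>h::half_edge. real (d (fst h)) - c)"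
  have fin: "finite H" by (simp add: H_def)
  have fstH: "fst h \<in> {1..n}" if "h \<in> H" for h using that by (auto simp: H_def half_edges_def)
  have dH: "degree H (fst h) = d (fst h)" if "h \<in> H" for h
    using degree_half_edges[OF fstH[OF that], of d] by (simp add: H_def)
  have di: "card (incident H i) = d i" using degree_half_edges[OF i] by (simp add: H_def degree_def)
  have sum_d: "3 * real n \<le> (\<Sum>i=1..n. real (d i))"
    using sum_bounded_below[of "{1..n}" 3 "\<lambda>i. real (d i)"] deg(1) by (simp add: mult.commute)
  have n: "0 < n" using i by simp
  then have sum_d_pos: "0 < (\<Sum>i=1..n. real (d i))" using sum_d by simp
  have c0: "0 \<le> c" using sum_d_pos by (simp add: c_def sum_nonneg)
  have cM: "c \<le> M"
  proof -
    have "(\<Sum>i=1..n. (real (d i))\<^sup>2) \<le> (\<Sum>i=1..n. real M * real (d i))"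
      unfolding power2_eq_square using deg(2) by (intro sum_mono mult_right_mono) auto
    then show ?thesis using sum_d_pos by (simp add: c_def divide_le_eq sum_distrib_left)
  qed
  have cardH: "real (card H) = (\<Sum>i=1..n. real (d i))" by (simp add: H_def card_half_edges)
  interpret W: centred_walk H M g M \<beta> "4 * l"
  proof
    show "\<bar>g h\<bar> \<le> real M" if "h \<in> H" for h
      using c0 cM deg(2)[OF fstH[OF that]] by (simp add: g_def abs_le_iff)
    have "sum g H = (\<Sum>(j, a)\<in>half_edges n d. real (d j) - c)"
      by (simp add: H_def g_def case_prod_unfold)
    also have "\<dots> = (\<Sum>j=1..n. \<Sum>a<d j. real (d j) - c)"
      unfolding half_edges_def by (rule sum.Sigma[symmetric]) auto
    also have "\<dots> = (\<Sum>i=1..n. (real (d i))\<^sup>2) - c * (\<Sum>i=1..n. real (d i))"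
      by (simp add: sum_subtractf sum_distrib_left power2_eq_square algebra_simps)
    also have "\<dots> = 0" using sum_d_pos by (simp add: c_def)
    finally show "sum g H = 0" .
    have pos: "0 < 3 * real n - 4 * real l - 1" using l by linarith
    then show b0: "0 \<le> \<beta>" by (simp add: \<beta>_def)
    have "real M * (real (4 * l) + 2) = \<beta> * (3 * real n - 4 * real l - 1)"
      using pos by (simp add: \<beta>_def)
    also have "\<dots> \<le> \<beta> * (real (card H) - real (4 * l) - 1)"
      using sum_d b0 cardH by (intro mult_left_mono) auto
    finally show "real M * (real (4 * l) + 2) \<le> \<beta> * (real (card H) - real (4 * l) - 1)" .
  qed (use fin dH deg fstH in auto)
  have "even (card H)" using even by (simp add: H_def card_half_edges)
  then have ne: "pairings H \<noteq> {}" using pairings_nonempty[OF fin] by blast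
  then obtain q where "q \<in> pairings H" by blast
  then have cyl: "cylinder H H (pairings H)" by (rule cylinder_pairings)
  have cardP: "0 < card (pairings H)" using ne finite_pairings[OF fin] by (simp add: card_gt_0_iff)
  let ?b = "(real M)\<^sup>2 / 2 ^ l + 2 * (2 * real l + 1) * ((real M)\<^sup>2 * \<beta>)"
  have d0: "0 < real (d i)" using deg(1)[OF i] by simp
  have bias_eq: "friendship_bias n d p (Suc l) i + real (d i) - c =
      (\<Sum>h\<in>incident H i. nb_mean H g l p h) / real (d i)" if "p \<in> pairings H" for p
    unfolding H_def g_def by (rule friendship_bias_Suc) (use that deg(1) i in \<open>auto simp: H_def\<close>)
  have "(\<Sum>p\<in>pairings H. (friendship_bias n d p (Suc l) i + real (d i) - c)\<^sup>2) =
      (\<Sum>p\<in>pairings H. ((\<Sum>h\<in>incident H i. nb_mean H g l p h) / real (d i))\<^sup>2)"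
    using bias_eq by simp
  also have "\<dots> \<le> (\<Sum>p\<in>pairings H. (\<Sum>h\<in>incident H i. (nb_mean H g l p h)\<^sup>2) / real (d i))"
  proof (rule sum_mono)
    fix p
    have "(\<Sum>h\<in>incident H i. nb_mean H g l p h)\<^sup>2 \<le> (\<Sum>h\<in>incident H i. (nb_mean H g l p h)\<^sup>2) * real (d i)"
      using sum_squared_le_sum_of_squares[of "nb_mean H g l p" "incident H i"] di by simp
    then show "((\<Sum>h\<in>incident H i. nb_mean H g l p h) / real (d i))\<^sup>2 \<le>
        (\<Sum>h\<in>incident H i. (nb_mean H g l p h)\<^sup>2) / real (d i)"
      using d0 by (simp add: power_divide divide_le_eq power2_eq_square field_simps)
  qed
  also have "\<dots> = (\<Sum>h\<in>incident H i. \<Sum>p\<in>pairings H. (nb_mean H g l p h)\<^sup>2) / real (d i)"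
    by (simp add: sum_divide_distrib[symmetric] sum.swap[of _ "incident H i"])
  also have "\<dots> \<le> (\<Sum>h\<in>incident H i. ?b * card (pairings H)) / real (d i)"
  proof (intro divide_right_mono sum_mono)
    fix h assume "h \<in> incident H i"
    then show "(\<Sum>p\<in>pairings H. (nb_mean H g l p h)\<^sup>2) \<le> ?b * card (pairings H)"
      by (intro W.second_moment[OF cyl]) (use incident_subset in auto)
  qed simp
  also have "\<dots> = ?b * card (pairings H)" using di d0 by simp
  finally have "(\<Sum>p\<in>pairings H. (friendship_bias n d p (Suc l) i + real (d i) - c)\<^sup>2) \<le>
    ?b * card (pairings H)" .
  then show ?thesis
    using ne cardP
    by (simp add: config_model_def H_def[symmetric] integral_pmf_of_set finite_pairings fin divide_le_eq)
qed

section \<open>Weak convergence to a constant, and of degree averages\<close>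

text \<open>
  Uniform continuity near \<open>{-a..a}\<close> for close points, boundedness for distant ones.  A quadratic
  modulus makes second moments sufficient to compare means of \<open>f\<close>.
\<close>

lemma quadratic_modulus:
  fixes f :: "real \<Rightarrow> real"
  assumes cont: "continuous_on UNIV f" and B: "\<And>x. \<bar>f x\<bar> \<le> B" and \<epsilon>: "0 < \<epsilon>"
  obtains C where "0 \<le> C" "\<And>x y. \<bar>y\<bar> \<le> a \<Longrightarrow> \<bar>f x - f y\<bar> \<le> \<epsilon> + C * (x - y)\<^sup>2"
proof -
  have "uniformly_continuous_on {-a-1..a+1} f"
    by (intro compact_uniformly_continuous continuous_on_subset[OF cont]) auto
  then obtain \<delta> where \<delta>: "0 < \<delta>" "\<And>x y. x \<in> {-a-1..a+1} \<Longrightarrow> y \<in> {-a-1..a+1} \<Longrightarrow>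
      \<bar>x - y\<bar> < \<delta> \<Longrightarrow> \<bar>f x - f y\<bar> < \<epsilon>"
    using \<epsilon> unfolding uniformly_continuous_on_def dist_real_def by metis
  define e where "e = min \<delta> 1"
  have e: "0 < e" "e \<le> \<delta>" "e \<le> 1" using \<delta> by (auto simp: e_def)
  have B0: "0 \<le> B" using B[of 0] by linarith
  show thesis
  proof (rule that[of "2 * B / e\<^sup>2"])
    show C0: "0 \<le> 2 * B / e\<^sup>2" using B0 by simp
    fix x y :: real assume y: "\<bar>y\<bar> \<le> a"
    show "\<bar>f x - f y\<bar> \<le> \<epsilon> + 2 * B / e\<^sup>2 * (x - y)\<^sup>2"
    proof (cases "\<bar>x - y\<bar> < e")
      case True
      then have "\<bar>f x - f y\<bar> < \<epsilon>" using y e by (intro \<delta>(2)) auto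
      moreover have "0 \<le> 2 * B / e\<^sup>2 * (x - y)\<^sup>2"
        by (rule mult_nonneg_nonneg[OF C0 zero_le_power2])
      ultimately show ?thesis by linarith
    next
      case False
      then have "e\<^sup>2 \<le> (x - y)\<^sup>2" using e by (metis abs_le_square_iff abs_of_pos linorder_not_less)
      then have "2 * B / e\<^sup>2 * e\<^sup>2 \<le> 2 * B / e\<^sup>2 * (x - y)\<^sup>2" using C0 by (rule mult_left_mono)
      then have "2 * B \<le> 2 * B / e\<^sup>2 * (x - y)\<^sup>2" using e by simp
      moreover have "\<bar>f x - f y\<bar> \<le> 2 * B" using B[of x] B[of y] by linarith
      ultimately show ?thesis using \<epsilon> by linarith
    qed
  qed
qed

lemma tendsto_0_approx:
  fixes u v :: "nat \<Rightarrow> real"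
  assumes v: "v \<longlonglongrightarrow> 0"
    and u: "\<And>\<epsilon>. 0 < \<epsilon> \<Longrightarrow> \<exists>C. \<forall>\<^sub>F n in sequentially. \<bar>u n\<bar> \<le> \<epsilon> + C * v n"
  shows "u \<longlonglongrightarrow> 0"
proof (rule tendstoI)
  fix e :: real assume e: "0 < e"
  obtain C where C: "\<forall>\<^sub>F n in sequentially. \<bar>u n\<bar> \<le> e / 2 + C * v n"
    using u[of "e / 2"] e by auto
  have "(\<lambda>n. C * v n) \<longlonglongrightarrow> C * 0" by (intro tendsto_intros v)
  then have "\<forall>\<^sub>F n in sequentially. C * v n < e / 2" by (rule order_tendstoD) (use e in simp)
  with C show "\<forall>\<^sub>F n in sequentially. dist (u n) 0 < e"
    by eventually_elim (simp add: dist_real_def)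
qed

text \<open>
  The quadratic modulus of a test function turns the second moment of \<open>Z n - z\<close> into a bound for
  the change of its mean.
\<close>

lemma weak_conv_m_constI:
  fixes Q :: "nat \<Rightarrow> 'a pmf" and Z :: "nat \<Rightarrow> 'a \<Rightarrow> real" and T :: "'b measure"
  assumes Z: "\<And>n \<omega>. \<bar>Z n \<omega>\<bar> \<le> B" and T: "prob_space T"
    and conv: "(\<lambda>n. measure_pmf.expectation (Q n) (\<lambda>\<omega>. (Z n \<omega> - z)\<^sup>2)) \<longlonglongrightarrow> 0"
  shows "weak_conv_m (\<lambda>n. distr (measure_pmf (Q n)) borel (Z n)) (distr T borel (\<lambda>_. z))"
proof (rule integral_bdd_continuous_conv_imp_weak_conv)
  interpret T: prob_space T by fact
  show "real_distribution (distr (measure_pmf (Q n)) borel (Z n))" for n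
    by (intro prob_space.real_distribution_distr[OF prob_space_measure_pmf]) simp
  show "real_distribution (distr T borel (\<lambda>_. z))"
    by (intro T.real_distribution_distr) simp
  fix f :: "real \<Rightarrow> real" assume f: "\<And>x. isCont f x" "\<And>x. \<bar>f x\<bar> \<le> 1"
  have cont: "continuous_on UNIV f" using f(1) by (simp add: continuous_at_imp_continuous_on)
  then have [measurable]: "f \<in> borel_measurable borel" by (rule borel_measurable_continuous_onI)
  have int: "integrable (measure_pmf (Q n)) (\<lambda>\<omega>. f (Z n \<omega>))" for n
    by (rule measure_pmf.integrable_const_bound[where B = 1]) (use f(2) in auto)
  have int2: "integrable (measure_pmf (Q n)) (\<lambda>\<omega>. (Z n \<omega> - z)\<^sup>2)" for n
  proof (rule measure_pmf.integrable_const_bound[where B = "(B + \<bar>z\<bar>)\<^sup>2"])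
    have "(Z n \<omega> - z)\<^sup>2 \<le> (B + \<bar>z\<bar>)\<^sup>2" for \<omega>
      using Z[of n \<omega>] by (intro abs_le_square_iff[THEN iffD1]) linarith
    then show "AE \<omega> in measure_pmf (Q n). norm ((Z n \<omega> - z)\<^sup>2) \<le> (B + \<bar>z\<bar>)\<^sup>2" by simp
  qed simp
  have "(\<lambda>n. measure_pmf.expectation (Q n) (\<lambda>\<omega>. f (Z n \<omega>)) - f z) \<longlonglongrightarrow> 0"
  proof (rule tendsto_0_approx[OF conv])
    fix \<epsilon> :: real assume "0 < \<epsilon>"
    from quadratic_modulus[OF cont f(2) this, of "\<bar>z\<bar>"] obtain C where C: "0 \<le> C"
      "\<And>x. \<bar>f x - f z\<bar> \<le> \<epsilon> + C * (x - z)\<^sup>2" by (metis order_refl)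
    have "\<bar>measure_pmf.expectation (Q n) (\<lambda>\<omega>. f (Z n \<omega>)) - f z\<bar> \<le>
        \<epsilon> + C * measure_pmf.expectation (Q n) (\<lambda>\<omega>. (Z n \<omega> - z)\<^sup>2)" for n
    proof -
      have "measure_pmf.expectation (Q n) (\<lambda>\<omega>. f (Z n \<omega>)) - f z =
          measure_pmf.expectation (Q n) (\<lambda>\<omega>. f (Z n \<omega>) - f z)"
        using int by simp
      also have "\<bar>\<dots>\<bar> \<le> measure_pmf.expectation (Q n) (\<lambda>\<omega>. \<bar>f (Z n \<omega>) - f z\<bar>)"
        by (rule integral_abs_bound)
      also have "\<dots> \<le> measure_pmf.expectation (Q n) (\<lambda>\<omega>. \<epsilon> + C * (Z n \<omega> - z)\<^sup>2)"
        by (rule integral_mono) (use int int2 C in auto)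
      also have "\<dots> = \<epsilon> + C * measure_pmf.expectation (Q n) (\<lambda>\<omega>. (Z n \<omega> - z)\<^sup>2)"
        using int2 by simp
      finally show ?thesis .
    qed
    then show "\<exists>C. \<forall>\<^sub>F n in sequentially.
        \<bar>measure_pmf.expectation (Q n) (\<lambda>\<omega>. f (Z n \<omega>)) - f z\<bar> \<le>
        \<epsilon> + C * measure_pmf.expectation (Q n) (\<lambda>\<omega>. (Z n \<omega> - z)\<^sup>2)"
      by (intro exI[of _ C]) simp
  qed
  from tendsto_add[OF this tendsto_const[of "f z"]]
  show "(\<lambda>n. integral\<^sup>L (distr (measure_pmf (Q n)) borel (Z n)) f)
      \<longlonglongrightarrow> integral\<^sup>L (distr T borel (\<lambda>_. z)) f"
    by (simp add: integral_distr T.prob_space integral_return)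
qed

text \<open>
  The bound on the degrees passes to the limit \<open>D\<close>, so the weak convergence may be tested
  against continuous functions that are unbounded, such as the moments.
\<close>

lemma degree_average_tendsto:
  fixes d :: "nat \<Rightarrow> nat \<Rightarrow> nat" and S :: "'a measure" and D :: "'a \<Rightarrow> nat" and f :: "real \<Rightarrow> real"
  assumes S: "prob_space S" and D: "D \<in> measurable S (count_space UNIV)"
    and conv: "weak_conv_m
          (\<lambda>n. distr (measure_pmf (pmf_of_set {1..n})) borel (\<lambda>i. real (d n i)))
          (distr S borel (\<lambda>\<omega>. real (D \<omega>)))"
    and dM: "\<And>n i. i \<in> {1..n} \<Longrightarrow> d n i \<le> M"
    and cont: "continuous_on UNIV f"
  shows "(\<lambda>n. (\<Sum>i=1..n. f (real (d n i))) / real n) \<longlonglongrightarrow> (\<integral>\<omega>. f (real (D \<omega>)) \<partial>S)"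
proof -
  interpret S: prob_space S by fact
  note [measurable] = D
  have lim: "(\<lambda>n. (\<Sum>i=1..n. h (real (d n i))) / real n) \<longlonglongrightarrow> (\<integral>\<omega>. h (real (D \<omega>)) \<partial>S)"
    if cont: "continuous_on UNIV h" and bound: "\<And>x. \<bar>h x\<bar> \<le> b" for h :: "real \<Rightarrow> real" and b
  proof -
    have [measurable]: "h \<in> borel_measurable borel" using cont by (rule borel_measurable_continuous_onI)
    have "isCont h x" for x using cont by (simp add: continuous_on_eq_continuous_at)
    then have "(\<lambda>n. integral\<^sup>L (distr (measure_pmf (pmf_of_set {1..n})) borel (\<lambda>i. real (d n i))) h)
        \<longlonglongrightarrow> integral\<^sup>L (distr S borel (\<lambda>\<omega>. real (D \<omega>))) h"
      by (intro weak_conv_imp_integral_bdd_continuous_conv[OF _ _ conv, where B = b]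
          prob_space.real_distribution_distr[OF prob_space_measure_pmf] S.real_distribution_distr) (use bound in auto)
    then have "(\<lambda>n. measure_pmf.expectation (pmf_of_set {1..n}) (\<lambda>i. h (real (d n i))))
        \<longlonglongrightarrow> (\<integral>\<omega>. h (real (D \<omega>)) \<partial>S)"
      by (simp add: integral_distr)
    moreover have "\<forall>\<^sub>F n in sequentially.
        measure_pmf.expectation (pmf_of_set {1..n}) (\<lambda>i. h (real (d n i))) =
        (\<Sum>i=1..n. h (real (d n i))) / real n"
      using eventually_gt_at_top[of 0] by eventually_elim (simp add: integral_pmf_of_set)
    ultimately show ?thesis by (rule Lim_transform_eventually)
  qed
  have DM: "AE \<omega> in S. D \<omega> \<le> M"
  proof -
    \<comment> \<open>a test function that vanishes exactly on \<open>{..M}\<close>\<close>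
    define h where "h x = min 1 (max 0 (x - real M))" for x :: real
    have "continuous_on UNIV h" unfolding h_def by (intro continuous_intros)
    moreover have "\<bar>h x\<bar> \<le> 1" for x by (auto simp: h_def)
    ultimately have "(\<lambda>n. (\<Sum>i=1..n. h (real (d n i))) / real n) \<longlonglongrightarrow> (\<integral>\<omega>. h (real (D \<omega>)) \<partial>S)"
      by (rule lim)
    moreover have "(\<lambda>n. (\<Sum>i=1..n. h (real (d n i))) / real n) = (\<lambda>_. 0)"
      using dM by (simp add: h_def fun_eq_iff)
    ultimately have "(\<integral>\<omega>. h (real (D \<omega>)) \<partial>S) = 0" by (simp only: LIMSEQ_const_iff)
    moreover have "integrable S (\<lambda>\<omega>. h (real (D \<omega>)))"
      by (rule S.integrable_const_bound[where B = 1]) (auto simp: h_def)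
    ultimately have "AE \<omega> in S. h (real (D \<omega>)) = 0"
      by (subst (asm) integral_nonneg_eq_0_iff_AE) (auto simp: h_def)
    then show ?thesis by eventually_elim (auto simp: h_def min_def max_def split: if_splits)
  qed
  show "(\<lambda>n. (\<Sum>i=1..n. f (real (d n i))) / real n) \<longlonglongrightarrow> (\<integral>\<omega>. f (real (D \<omega>)) \<partial>S)"
  proof -
    define h where "h x = f (min (real M) (max 0 x))" for x
    have "continuous_on UNIV h"
      unfolding h_def by (intro continuous_on_compose2[OF cont] continuous_intros) auto
    moreover obtain b where "\<And>x. x \<in> {0..real M} \<Longrightarrow> \<bar>f x\<bar> \<le> b"
    proof -
      have "bounded (f ` {0..real M})"
        by (intro compact_imp_bounded compact_continuous_image continuous_on_subset[OF cont]) auto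
      then obtain b where "\<forall>x\<in>{0..real M}. \<bar>f x\<bar> \<le> b" by (auto simp: bounded_iff)
      then show thesis by (intro that) blast
    qed
    then have "\<bar>h x\<bar> \<le> b" for x by (simp add: h_def)
    ultimately have "(\<lambda>n. (\<Sum>i=1..n. h (real (d n i))) / real n) \<longlonglongrightarrow> (\<integral>\<omega>. h (real (D \<omega>)) \<partial>S)"
      by (rule lim)
    moreover have "(\<Sum>i=1..n. h (real (d n i))) = (\<Sum>i=1..n. f (real (d n i)))" for n
      using dM by (intro sum.cong refl) (simp add: h_def min_absorb2)
    moreover have "(\<integral>\<omega>. h (real (D \<omega>)) \<partial>S) = (\<integral>\<omega>. f (real (D \<omega>)) \<partial>S)"
    proof (rule integral_cong_AE)
      have [measurable]: "f \<in> borel_measurable borel" using cont by (rule borel_measurable_continuous_onI)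
      show "(\<lambda>\<omega>. h (real (D \<omega>))) \<in> borel_measurable S" unfolding h_def by measurable
      show "(\<lambda>\<omega>. f (real (D \<omega>))) \<in> borel_measurable S" by measurable
      show "AE \<omega> in S. h (real (D \<omega>)) = f (real (D \<omega>))"
        using DM by eventually_elim (simp add: h_def)
    qed
    ultimately show ?thesis by simp
  qed
qed

section \<open>Asymptotics\<close>

lemma degree_bounds:
  fixes d :: "nat \<Rightarrow> nat \<Rightarrow> nat"
  assumes inf: "(INF n\<in>{1..}. INF i\<in>{1..n}. enat (d n i)) \<ge> 3"
    and sup: "(SUP n\<in>{1..}. SUP i\<in>{1..n}. enat (d n i)) = enat M"
    and i: "i \<in> {1..n}"
  shows "3 \<le> d n i" "d n i \<le> M"
proof -
  have n: "n \<in> {1..}" using i by simp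
  have "(3::enat) \<le> (INF i\<in>{1..n}. enat (d n i))" by (rule order_trans[OF inf INF_lower[OF n]])
  also have "\<dots> \<le> enat (d n i)" by (rule INF_lower[OF i])
  finally show "3 \<le> d n i" by (simp add: numeral_eq_enat)
  have "enat (d n i) \<le> (SUP i\<in>{1..n}. enat (d n i))" by (rule SUP_upper[OF i])
  also have "\<dots> \<le> enat M" unfolding sup[symmetric] by (rule SUP_upper[OF n])
  finally show "d n i \<le> M" by simp
qed

text \<open>
  The hypothesis on \<open>k\<close> gives \<open>k \<le> ln m \<le> m\<close>, and \<open>m\<close> is \<open>o(\<surd>n)\<close>.  If \<open>m n = 0\<close>, the convention
  \<open>ln 0 = 0\<close> forces \<open>k n = 0\<close>.
\<close>

lemma walk_length_small:
  fixes m k dmax :: "nat \<Rightarrow> nat" and M :: nat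
  assumes m: "(\<lambda>n. real (m n)) \<in> o(\<lambda>n. sqrt (real n / real (dmax n)))"
    and k: "\<And>n. n \<ge> 1 \<Longrightarrow> real (k n) \<le> ln (real (m n)) / (2 * ln (real M))"
    and M: "3 \<le> M"
  shows "(\<lambda>n. (real (k n))\<^sup>2 / real n) \<longlonglongrightarrow> 0"
proof (rule tendsto_0_approx[where v = "\<lambda>_. 0"])
  fix \<epsilon> :: real assume \<epsilon>: "0 < \<epsilon>"
  have "1 \<le> ln (real M)"
  proof -
    have "exp 1 \<le> real M" using exp_le M by linarith
    then show ?thesis using M by (subst ln_ge_iff) auto
  qed
  have km: "real (k n) \<le> real (m n)" if "n \<ge> 1" for n
  proof (cases "m n = 0")
    case True
    then show ?thesis using k[OF that] by simp
  next
    case False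
    then have "0 \<le> ln (real (m n))" by simp
    have "real (k n) \<le> ln (real (m n)) / (2 * ln (real M))" by (rule k[OF that])
    also have "\<dots> \<le> ln (real (m n)) / 1"
      using \<open>0 \<le> ln (real (m n))\<close> \<open>1 \<le> ln (real M)\<close> by (intro divide_left_mono) auto
    also have "\<dots> \<le> real (m n)" using ln_le_minus_one[of "real (m n)"] False by simp
    finally show ?thesis .
  qed
  have "\<forall>\<^sub>F n in sequentially. norm (real (m n)) \<le> sqrt \<epsilon> * norm (sqrt (real n / real (dmax n)))"
    using landau_o.smallD[OF m, of "sqrt \<epsilon>"] \<epsilon> by simp
  then have "\<forall>\<^sub>F n in sequentially. \<bar>(real (k n))\<^sup>2 / real n\<bar> \<le> \<epsilon> + 0 * 0"
    using eventually_ge_at_top[of 1]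
  proof eventually_elim
    case (elim n)
    \<comment> \<open>also for \<open>dmax n = 0\<close>, where the quotient is \<open>0\<close>\<close>
    have "real n / real (dmax n) \<le> real n"
      by (cases "dmax n = 0") (auto simp: divide_le_eq mult_le_cancel_left1)
    then have "sqrt (real n / real (dmax n)) \<le> sqrt (real n)" by simp
    then have "real (m n) \<le> sqrt \<epsilon> * sqrt (real n)"
      using elim(1) \<epsilon> by (smt (verit) mult_left_mono real_norm_def real_sqrt_ge_zero norm_of_nat
          of_nat_0_le_iff zero_le_divide_iff)
    then have "real (k n) \<le> sqrt (\<epsilon> * real n)"
      using km[OF elim(2)] by (simp add: real_sqrt_mult)
    then have "(real (k n))\<^sup>2 \<le> (sqrt (\<epsilon> * real n))\<^sup>2" by (intro power_mono) auto
    also have "\<dots> = \<epsilon> * real n" using \<epsilon> by simp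
    finally show ?case using elim(2) by (simp add: divide_le_eq)
  qed
  then show "\<exists>C. \<forall>\<^sub>F n in sequentially. \<bar>(real (k n))\<^sup>2 / real n\<bar> \<le> \<epsilon> + C * 0"
    by (intro exI[of _ 0]) simp
qed simp

text \<open>
  A walk of \<open>k\<close> steps has its first half-edge and \<open>l = k - 1\<close> further choices.  The error of
  \<open>bias_second_moment\<close> is simplified using \<open>3 n - 4 l - 1 \<ge> n\<close> and \<open>2 l + 1 \<le> 2 k\<close>.
\<close>

lemma moment_bound_tendsto:
  fixes k :: "nat \<Rightarrow> nat" and M :: nat
  assumes k: "filterlim k at_top sequentially"
    and k2: "(\<lambda>n. (real (k n))\<^sup>2 / real n) \<longlonglongrightarrow> 0"
  defines "b \<equiv> \<lambda>n. (real M)\<^sup>2 / 2 ^ (k n - 1) + 16 * real M ^ 3 * ((real (k n))\<^sup>2 / real n)"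
  shows "b \<longlonglongrightarrow> 0"
    and "\<forall>\<^sub>F n in sequentially. 1 \<le> n \<and> k n = Suc (k n - 1) \<and> 4 * (k n - 1) + 1 < 3 * n \<and>
      (real M)\<^sup>2 / 2 ^ (k n - 1) + 2 * (2 * real (k n - 1) + 1) * ((real M)\<^sup>2 *
        (real M * (4 * real (k n - 1) + 2) / (3 * real n - 4 * real (k n - 1) - 1))) \<le> b n"
proof -
  have k1: "filterlim (\<lambda>n. k n - 1) at_top sequentially"
    by (rule filterlim_compose[OF filterlim_minus_const_nat_at_top k])
  have "(\<lambda>l. (real M)\<^sup>2 * (1 / 2) ^ l) \<longlonglongrightarrow> (real M)\<^sup>2 * 0"
    by (intro tendsto_mult_left LIMSEQ_power_zero) simp
  from filterlim_compose[OF this k1]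
  have "(\<lambda>n. (real M)\<^sup>2 / 2 ^ (k n - 1)) \<longlonglongrightarrow> 0" by (simp add: power_divide)
  from tendsto_add[OF this tendsto_mult_left[OF k2, of "16 * real M ^ 3"]]
  show "b \<longlonglongrightarrow> 0" by (simp add: b_def)
  have "\<forall>\<^sub>F n in sequentially. (real (k n))\<^sup>2 / real n < 1 / 2"
    by (rule order_tendstoD(2)[OF k2]) simp
  moreover have "\<forall>\<^sub>F n in sequentially. 1 \<le> k n"
    using k by (simp add: filterlim_at_top)
  ultimately show "\<forall>\<^sub>F n in sequentially. 1 \<le> n \<and> k n = Suc (k n - 1) \<and> 4 * (k n - 1) + 1 < 3 * n \<and>
      (real M)\<^sup>2 / 2 ^ (k n - 1) + 2 * (2 * real (k n - 1) + 1) * ((real M)\<^sup>2 *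
        (real M * (4 * real (k n - 1) + 2) / (3 * real n - 4 * real (k n - 1) - 1))) \<le> b n"
    using eventually_ge_at_top[of 1]
  proof eventually_elim
    case (elim n)
    define l x where "l = real (k n - 1)" and "x = real (k n)"
    have lx: "l = x - 1" "1 \<le> x" using elim(2) by (auto simp: l_def x_def of_nat_diff)
    have n: "0 < real n" using elim(3) by simp
    have "x\<^sup>2 < real n / 2" using elim(1) n by (simp add: x_def field_simps)
    moreover have "x \<le> x\<^sup>2" using lx by (simp add: power2_eq_square)
    ultimately have den: "real n \<le> 3 * real n - 4 * l - 1" "4 * l + 1 < 3 * real n"
      using lx n by linarith+
    have "2 * (2 * l + 1) * (real M ^ 2 * (real M * (4 * l + 2) / (3 * real n - 4 * l - 1)))
        \<le> 2 * (2 * l + 1) * (real M ^ 2 * (real M * (4 * l + 2) / real n))"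
      using lx n den by (intro mult_left_mono divide_left_mono) auto
    also have "\<dots> = 8 * (l + 1/2)\<^sup>2 * (2 * real M ^ 3 / real n)"
      using n by (simp add: field_simps power2_eq_square power3_eq_cube)
    also have "\<dots> \<le> 8 * x\<^sup>2 * (2 * real M ^ 3 / real n)"
      using lx n by (intro mult_right_mono mult_left_mono power_mono) auto
    finally have "2 * (2 * l + 1) * (real M ^ 2 * (real M * (4 * l + 2) / (3 * real n - 4 * l - 1)))
        \<le> 16 * real M ^ 3 * (x\<^sup>2 / real n)" by (simp add: field_simps)
    moreover have "4 * (k n - 1) + 1 < 3 * n"
      using den(2) unfolding l_def by linarith
    ultimately show ?case
      using elim(2,3) unfolding b_def l_def x_def by simp
  qed
qed

text \<open>
  A bounded quantity satisfies \<open>\<bar>Z - z\<bar>\<^sup>2 \<le> 2 B \<bar>Z - z\<bar>\<close>, and \<open>\<bar>Z - z\<bar>\<close> is at most \<open>\<bar>w - z\<bar>\<close> plus the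
  average of the differences \<open>f \<Delta>\<^sub>i - f (c - d\<^sub>i)\<close>, to which the quadratic modulus of \<open>f\<close> applies.
\<close>

lemma empirical_bias_second_moment:
  fixes n l M :: nat and d :: "nat \<Rightarrow> nat" and f :: "real \<Rightarrow> real" and c z B C \<epsilon> :: real
  assumes even: "even (\<Sum>i=1..n. d i)"
    and deg: "\<And>i. i \<in> {1..n} \<Longrightarrow> 3 \<le> d i" "\<And>i. i \<in> {1..n} \<Longrightarrow> d i \<le> M"
    and n: "1 \<le> n" and l: "4 * l + 1 < 3 * n"
    and f: "\<And>x. \<bar>f x\<bar> \<le> B" and z: "\<bar>z\<bar> \<le> B"
    and C: "0 \<le> C" "\<And>x i. i \<in> {1..n} \<Longrightarrow>
      \<bar>f x - f (c - real (d i))\<bar> \<le> \<epsilon> + C * (x - (c - real (d i)))\<^sup>2"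
  defines "c\<^sub>n \<equiv> (\<Sum>i=1..n. (real (d i))\<^sup>2) / (\<Sum>i=1..n. real (d i))"
    and "w \<equiv> (\<Sum>i=1..n. f (c - real (d i))) / real n"
    and "b \<equiv> (real M)\<^sup>2 / 2 ^ l + 2 * (2 * real l + 1) * ((real M)\<^sup>2 *
        (real M * (4 * real l + 2) / (3 * real n - 4 * real l - 1)))"
  shows "measure_pmf.expectation (config_model n d)
      (\<lambda>p. ((\<Sum>i=1..n. f (friendship_bias n d p (Suc l) i)) / real n - z)\<^sup>2)
    \<le> 2 * B * (\<epsilon> + C * (2 * b + 2 * (c\<^sub>n - c)\<^sup>2) + \<bar>w - z\<bar>)"
proof -
  let ?E = "measure_pmf.expectation (config_model n d)"
  let ?\<Delta> = "\<lambda>p i. friendship_bias n d p (Suc l) i"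
  let ?Z = "\<lambda>p. (\<Sum>i=1..n. f (?\<Delta> p i)) / real n"
  have B0: "0 \<le> B" using z by linarith
  have "pairings (half_edges n d) \<noteq> {}" using even by (intro pairings_nonempty) (simp_all add: card_half_edges)
  then have fin: "finite (set_pmf (config_model n d))"
    by (simp add: config_model_def finite_pairings)
  have int: "integrable (measure_pmf (config_model n d)) h" for h :: "_ \<Rightarrow> real"
    using fin by (rule integrable_measure_pmf_finite)
  have avg_bound: "\<bar>?Z p\<bar> \<le> B" for p
    using abs_mean_le[of "{1..n}" "\<lambda>i. f (?\<Delta> p i)" B] f B0 by simp
  have square_sum: "(u + v)\<^sup>2 \<le> 2 * u\<^sup>2 + 2 * v\<^sup>2" for u v :: real
    using zero_le_power2[of "u - v"] by (simp add: power2_eq_square algebra_simps)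
  have pointwise: "(?Z p - z)\<^sup>2 \<le> 2 * B * (\<epsilon> +
      C * (\<Sum>i=1..n. 2 * (?\<Delta> p i + real (d i) - c\<^sub>n)\<^sup>2 + 2 * (c\<^sub>n - c)\<^sup>2) / real n + \<bar>w - z\<bar>)" for p
  proof -
    have "\<bar>?Z p - w\<bar> = \<bar>\<Sum>i=1..n. f (?\<Delta> p i) - f (c - real (d i))\<bar> / real n"
      by (simp add: w_def sum_subtractf diff_divide_distrib[symmetric])
    also have "\<dots> \<le> (\<Sum>i=1..n. \<epsilon> + C * (2 * (?\<Delta> p i + real (d i) - c\<^sub>n)\<^sup>2 + 2 * (c\<^sub>n - c)\<^sup>2)) / real n"
    proof (intro divide_right_mono order_trans[OF sum_abs] sum_mono)
      fix i assume i: "i \<in> {1..n}"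
      have "(?\<Delta> p i - (c - real (d i)))\<^sup>2 = ((?\<Delta> p i + real (d i) - c\<^sub>n) + (c\<^sub>n - c))\<^sup>2"
        by (simp add: algebra_simps)
      also have "\<dots> \<le> 2 * (?\<Delta> p i + real (d i) - c\<^sub>n)\<^sup>2 + 2 * (c\<^sub>n - c)\<^sup>2"
        by (rule square_sum)
      finally show "\<bar>f (?\<Delta> p i) - f (c - real (d i))\<bar> \<le>
          \<epsilon> + C * (2 * (?\<Delta> p i + real (d i) - c\<^sub>n)\<^sup>2 + 2 * (c\<^sub>n - c)\<^sup>2)"
        using C(2)[OF i, of "?\<Delta> p i"] C(1) by (smt (verit) mult_left_mono)
    qed simp
    also have "\<dots> = \<epsilon> + C * (\<Sum>i=1..n. 2 * (?\<Delta> p i + real (d i) - c\<^sub>n)\<^sup>2 + 2 * (c\<^sub>n - c)\<^sup>2) / real n"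
      using n by (simp add: sum.distrib sum_distrib_left add_divide_distrib algebra_simps)
    finally have "\<bar>?Z p - z\<bar> \<le>
        \<epsilon> + C * (\<Sum>i=1..n. 2 * (?\<Delta> p i + real (d i) - c\<^sub>n)\<^sup>2 + 2 * (c\<^sub>n - c)\<^sup>2) / real n + \<bar>w - z\<bar>"
      by linarith
    moreover have "\<bar>?Z p - z\<bar> \<le> 2 * B" using avg_bound[of p] z by linarith
    ultimately have "\<bar>?Z p - z\<bar> * \<bar>?Z p - z\<bar> \<le> 2 * B * (\<epsilon> +
        C * (\<Sum>i=1..n. 2 * (?\<Delta> p i + real (d i) - c\<^sub>n)\<^sup>2 + 2 * (c\<^sub>n - c)\<^sup>2) / real n + \<bar>w - z\<bar>)"
      using B0 by (intro mult_mono) auto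
    then show ?thesis by (simp add: power2_eq_square abs_mult_self_eq)
  qed
  have "?E (\<lambda>p. (?Z p - z)\<^sup>2) \<le> ?E (\<lambda>p. 2 * B * (\<epsilon> +
      C * (\<Sum>i=1..n. 2 * (?\<Delta> p i + real (d i) - c\<^sub>n)\<^sup>2 + 2 * (c\<^sub>n - c)\<^sup>2) / real n + \<bar>w - z\<bar>))"
    by (rule integral_mono[OF int int]) (rule pointwise)
  also have "\<dots> = 2 * B * (\<epsilon> + C * (\<Sum>i=1..n. 2 * ?E (\<lambda>p. (?\<Delta> p i + real (d i) - c\<^sub>n)\<^sup>2)
      + 2 * (c\<^sub>n - c)\<^sup>2) / real n + \<bar>w - z\<bar>)"
    by (simp add: int Bochner_Integration.integral_sum)
  also have "\<dots> \<le> 2 * B * (\<epsilon> + C * (\<Sum>i=1..n. 2 * b + 2 * (c\<^sub>n - c)\<^sup>2) / real n + \<bar>w - z\<bar>)"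
    using bias_second_moment[OF even deg l] B0 C(1)
    by (intro mult_left_mono add_mono divide_right_mono sum_mono order_refl)
      (auto simp: c\<^sub>n_def b_def)
  also have "\<dots> = 2 * B * (\<epsilon> + C * (2 * b + 2 * (c\<^sub>n - c)\<^sup>2) + \<bar>w - z\<bar>)"
    using n by simp
  finally show ?thesis .
qed

theorem theorem5p3:
  fixes d :: "nat \<Rightarrow> nat \<Rightarrow> nat" and M :: nat and m k :: "nat \<Rightarrow> nat"
    and S :: "'a measure" and D :: "'a \<Rightarrow> nat"
    and T :: "'b measure" and d\<^sub>\<phi> :: "'b \<Rightarrow> nat"
  assumes even_total: "\<And>n. n \<ge> 1 \<Longrightarrow> even (\<Sum>i=1..n. d n i)"
    and inf_degree: "(INF n\<in>{1..}. INF i\<in>{1..n}. enat (d n i)) \<ge> 3"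
    and sup_degree: "(SUP n\<in>{1..}. SUP i\<in>{1..n}. enat (d n i)) = enat M"
    and d_max_small: "(\<lambda>n. real (max_degree n (d n))) \<in> o(\<lambda>n. real n)"
    and m_small: "(\<lambda>n. real (m n)) \<in> o(\<lambda>n. sqrt (real n / real (max_degree n (d n))))"
    and prob_space_S: "prob_space S"
    and D_measurable: "D \<in> measurable S (count_space UNIV)"
    and D_conv: "weak_conv_m
          (\<lambda>n. distr (measure_pmf (pmf_of_set {1..n})) borel (\<lambda>i. real (d n i)))
          (distr S borel (\<lambda>\<omega>. real (D \<omega>)))"
    and D_pos: "measure S {\<omega> \<in> space S. D \<omega> \<ge> 1} = 1"
    and k_bound: "\<And>n. n \<ge> 1 \<Longrightarrow> real (k n) \<le> ln (real (m n)) / (2 * ln (real M))"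
    and k_lim: "filterlim k at_top sequentially"
    and prob_space_T: "prob_space T"
    and d\<^sub>\<phi>_measurable: "d\<^sub>\<phi> \<in> measurable T (count_space UNIV)"
    and d\<^sub>\<phi>_law: "distr T (count_space UNIV) d\<^sub>\<phi> = distr S (count_space UNIV) D"
  shows "weak_conv_in_distribution
           (\<lambda>n. measure_pmf (config_model n (d n)))
           (\<lambda>n G. bias_measure n (d n) G (k n))
           T
           (\<lambda>_. distr T borel
              (\<lambda>\<omega>. (\<integral>x. (real (D x))\<^sup>2 \<partial>S) / (\<integral>x. real (D x) \<partial>S) - real (d\<^sub>\<phi> \<omega>)))"
  unfolding weak_conv_in_distribution_def
proof (intro allI impI)
  fix f :: "real \<Rightarrow> real" assume f: "continuous_on UNIV f \<and> bounded (range f)"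
  then have cont: "continuous_on UNIV f" by simp
  then have [measurable]: "f \<in> borel_measurable borel" by (rule borel_measurable_continuous_onI)
  from f obtain B where B: "\<And>x. \<bar>f x\<bar> \<le> B" by (auto simp: bounded_iff)
  then have B0: "0 \<le> B" by (meson abs_ge_zero order_trans)
  interpret S: prob_space S by fact
  interpret T: prob_space T by fact
  note [measurable] = D_measurable d\<^sub>\<phi>_measurable
  note deg = degree_bounds[OF inf_degree sup_degree]
  have M3: "3 \<le> M" using deg[of 1 1] by simp
  note average = degree_average_tendsto[OF prob_space_S D_measurable D_conv deg(2)]
  define c where "c = (\<integral>x. (real (D x))\<^sup>2 \<partial>S) / (\<integral>x. real (D x) \<partial>S)"
  define z where "z = (\<integral>\<omega>. f (c - real (d\<^sub>\<phi> \<omega>)) \<partial>T)"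
  define c\<^sub>n where "c\<^sub>n n = (\<Sum>i=1..n. (real (d n i))\<^sup>2) / (\<Sum>i=1..n. real (d n i))" for n
  define w where "w n = (\<Sum>i=1..n. f (c - real (d n i))) / real n" for n
  have z_eq: "z = (\<integral>\<omega>. f (c - real (D \<omega>)) \<partial>S)"
  proof -
    have "z = (\<integral>j. f (c - real j) \<partial>distr T (count_space UNIV) d\<^sub>\<phi>)"
      unfolding z_def by (simp add: integral_distr)
    also have "\<dots> = (\<integral>\<omega>. f (c - real (D \<omega>)) \<partial>S)"
      unfolding d\<^sub>\<phi>_law by (simp add: integral_distr)
    finally show ?thesis .
  qed
  have zB: "\<bar>z\<bar> \<le> B"
  proof -
    have "\<bar>z\<bar> \<le> (\<integral>\<omega>. \<bar>f (c - real (d\<^sub>\<phi> \<omega>))\<bar> \<partial>T)" unfolding z_def by (rule integral_abs_bound)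
    also have "\<dots> \<le> B"
      by (rule T.integral_le_const) (auto intro!: T.integrable_const_bound[where B = B] simp: B)
    finally show ?thesis .
  qed
  have "w \<longlonglongrightarrow> z"
    unfolding w_def z_eq
    by (intro average continuous_on_compose2[OF cont] continuous_intros) auto
  then have w0: "(\<lambda>n. \<bar>w n - z\<bar>) \<longlonglongrightarrow> 0" by (simp add: LIM_zero tendsto_rabs_zero)
  have c_lim: "c\<^sub>n \<longlonglongrightarrow> c"
  proof -
    have D1: "(\<lambda>n. (\<Sum>i=1..n. real (d n i)) / real n) \<longlonglongrightarrow> (\<integral>x. real (D x) \<partial>S)"
      by (rule average) (auto intro: continuous_intros)
    have D2: "(\<lambda>n. (\<Sum>i=1..n. (real (d n i))\<^sup>2) / real n) \<longlonglongrightarrow> (\<integral>x. (real (D x))\<^sup>2 \<partial>S)"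
      by (rule average) (auto intro: continuous_intros)
    have "3 \<le> (\<integral>x. real (D x) \<partial>S)"
    proof (rule tendsto_lowerbound[OF D1])
      show "\<forall>\<^sub>F n in sequentially. 3 \<le> (\<Sum>i=1..n. real (d n i)) / real n"
        using eventually_ge_at_top[of 1]
      proof eventually_elim
        case (elim n)
        have "real (card {1..n}) * 3 \<le> (\<Sum>i=1..n. real (d n i))"
          by (rule sum_bounded_below) (use deg(1) in force)
        then show ?case using elim by (simp add: le_divide_eq mult.commute)
      qed
    qed simp
    then have "(\<lambda>n. ((\<Sum>i=1..n. (real (d n i))\<^sup>2) / real n) / ((\<Sum>i=1..n. real (d n i)) / real n))
        \<longlonglongrightarrow> c"
      unfolding c_def by (intro tendsto_divide D1 D2) auto
    moreover have "\<forall>\<^sub>F n in sequentially.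
        ((\<Sum>i=1..n. (real (d n i))\<^sup>2) / real n) / ((\<Sum>i=1..n. real (d n i)) / real n) = c\<^sub>n n"
      using eventually_ge_at_top[of 1] by eventually_elim (simp add: c\<^sub>n_def)
    ultimately show ?thesis by (rule Lim_transform_eventually)
  qed
  have c0: "(\<lambda>n. (c\<^sub>n n - c)\<^sup>2) \<longlonglongrightarrow> 0"
    using tendsto_power[OF LIM_zero[OF c_lim], of 2] by simp
  have k2: "(\<lambda>n. (real (k n))\<^sup>2 / real n) \<longlonglongrightarrow> 0"
    by (rule walk_length_small[OF m_small _ M3]) (rule k_bound)
  define b where
    "b n = (real M)\<^sup>2 / 2 ^ (k n - 1) + 16 * real M ^ 3 * ((real (k n))\<^sup>2 / real n)" for n
  have b0: "b \<longlonglongrightarrow> 0" unfolding b_def by (rule moment_bound_tendsto(1)[OF k_lim k2])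
  define Z where "Z n p = (\<integral>x. f x \<partial>bias_measure n (d n) p (k n))" for n p
  have Z_pmf: "Z n p =
      measure_pmf.expectation (pmf_of_set {1..n}) (\<lambda>i. f (friendship_bias n (d n) p (k n) i))" for n p
    unfolding Z_def bias_measure_def by (simp add: integral_distr)
  have ZB: "\<bar>Z n p\<bar> \<le> B" for n p
  proof -
    let ?g = "\<lambda>i. f (friendship_bias n (d n) p (k n) i)"
    have "\<bar>Z n p\<bar> \<le> measure_pmf.expectation (pmf_of_set {1..n}) (\<lambda>i. \<bar>?g i\<bar>)"
      unfolding Z_pmf by (rule integral_abs_bound)
    also have "\<dots> \<le> B"
      by (rule measure_pmf.integral_le_const)
        (auto intro!: measure_pmf.integrable_const_bound[where B = B] simp: B)
    finally show ?thesis .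
  qed
  have "(\<lambda>n. measure_pmf.expectation (config_model n (d n)) (\<lambda>p. (Z n p - z)\<^sup>2)) \<longlonglongrightarrow> 0"
  proof (rule tendsto_0_approx)
    show "(\<lambda>n. b n + (c\<^sub>n n - c)\<^sup>2 + \<bar>w n - z\<bar>) \<longlonglongrightarrow> 0"
      using tendsto_add[OF tendsto_add[OF b0 c0] w0] by simp
    fix \<epsilon> :: real assume \<epsilon>: "0 < \<epsilon>"
    \<comment> \<open>chosen so that \<open>2 B \<epsilon>' \<le> \<epsilon>\<close>; adding \<open>1\<close> allows for \<open>B = 0\<close>\<close>
    define \<epsilon>' where "\<epsilon>' = \<epsilon> / (2 * B + 1)"
    have \<epsilon>': "0 < \<epsilon>'" "2 * B * \<epsilon>' \<le> \<epsilon>"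
      using \<epsilon> B0 by (simp_all add: \<epsilon>'_def divide_le_eq algebra_simps)
    \<comment> \<open>every \<open>c - d\<^sub>i\<close> lies within \<open>\<bar>c\<bar> + M\<close> of \<open>0\<close>\<close>
    from quadratic_modulus[OF cont B \<epsilon>'(1), of "\<bar>c\<bar> + real M"] obtain C where C: "0 \<le> C"
      "\<And>x y. \<bar>y\<bar> \<le> \<bar>c\<bar> + real M \<Longrightarrow> \<bar>f x - f y\<bar> \<le> \<epsilon>' + C * (x - y)\<^sup>2" by metis
    let ?K = "2 * B * (2 * C + 1)"
    have "\<forall>\<^sub>F n in sequentially.
        \<bar>measure_pmf.expectation (config_model n (d n)) (\<lambda>p. (Z n p - z)\<^sup>2)\<bar> \<le>
        \<epsilon> + ?K * (b n + (c\<^sub>n n - c)\<^sup>2 + \<bar>w n - z\<bar>)"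
      using moment_bound_tendsto(2)[OF k_lim k2, of M]
    proof eventually_elim
      case (elim n)
      let ?l = "k n - 1"
      let ?b = "(real M)\<^sup>2 / 2 ^ ?l + 2 * (2 * real ?l + 1) * ((real M)\<^sup>2 *
        (real M * (4 * real ?l + 2) / (3 * real n - 4 * real ?l - 1)))"
      have n: "1 \<le> n" and ks: "k n = Suc ?l" and l: "4 * ?l + 1 < 3 * n" and bn: "?b \<le> b n"
        using elim unfolding b_def by blast+
      have Z_sum: "Z n p = (\<Sum>i=1..n. f (friendship_bias n (d n) p (Suc ?l) i)) / real n" for p
        unfolding Z_pmf using n ks by (simp add: integral_pmf_of_set)
      have "\<bar>f x - f (c - real (d n i))\<bar> \<le> \<epsilon>' + C * (x - (c - real (d n i)))\<^sup>2"
        if "i \<in> {1..n}" for x i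
        using deg(2)[OF that] by (intro C(2)) linarith
      from empirical_bias_second_moment[OF even_total[OF n] deg n l B zB C(1) this]
      have "measure_pmf.expectation (config_model n (d n)) (\<lambda>p. (Z n p - z)\<^sup>2) \<le>
          2 * B * (\<epsilon>' + C * (2 * ?b + 2 * (c\<^sub>n n - c)\<^sup>2) + \<bar>w n - z\<bar>)"
        unfolding Z_sum c\<^sub>n_def w_def .
      also have "\<dots> \<le> 2 * B * (\<epsilon>' + C * (2 * b n + 2 * (c\<^sub>n n - c)\<^sup>2) + \<bar>w n - z\<bar>)"
        using bn B0 C(1) by (intro mult_left_mono add_mono order_refl) auto
      also have "\<dots> \<le> 2 * B * (\<epsilon>' + (2 * C + 1) * (b n + (c\<^sub>n n - c)\<^sup>2 + \<bar>w n - z\<bar>))"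
      proof (intro mult_left_mono)
        have "0 \<le> b n" by (simp add: b_def)
        then show "\<epsilon>' + C * (2 * b n + 2 * (c\<^sub>n n - c)\<^sup>2) + \<bar>w n - z\<bar> \<le>
            \<epsilon>' + (2 * C + 1) * (b n + (c\<^sub>n n - c)\<^sup>2 + \<bar>w n - z\<bar>)"
          using C(1) by (simp add: algebra_simps)
      qed (use B0 in simp)
      also have "\<dots> \<le> \<epsilon> + ?K * (b n + (c\<^sub>n n - c)\<^sup>2 + \<bar>w n - z\<bar>)"
        using \<epsilon>'(2) by (simp add: algebra_simps)
      finally show ?case by simp
    qed
    then show "\<exists>C. \<forall>\<^sub>F n in sequentially.
        \<bar>measure_pmf.expectation (config_model n (d n)) (\<lambda>p. (Z n p - z)\<^sup>2)\<bar> \<le>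
        \<epsilon> + C * (b n + (c\<^sub>n n - c)\<^sup>2 + \<bar>w n - z\<bar>)" by blast
  qed
  from weak_conv_m_constI[OF ZB prob_space_T this]
  show "weak_conv_m
      (\<lambda>n. distr (measure_pmf (config_model n (d n))) borel
        (\<lambda>\<omega>. \<integral>x. f x \<partial>bias_measure n (d n) \<omega> (k n)))
      (distr T borel (\<lambda>\<omega>. \<integral>x. f x \<partial>distr T borel
        (\<lambda>\<omega>. (\<integral>x. (real (D x))\<^sup>2 \<partial>S) / (\<integral>x. real (D x) \<partial>S) - real (d\<^sub>\<phi> \<omega>))))"
    by (simp add: Z_def z_def c_def integral_distr)
qed

end
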